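(* Let $G=(V,E)$ be a finite simple connected graph with $|V|=k\ge 2$ and blowup-polynomial $p_G(n_1,\dots,n_k)$, and let $$\widetilde p_G(z_0,z_1,\dots,z_k):=(-z_0)^k\,p_G\!\left(\frac{z_1}{-z_0},\dots,\frac{z_k}{-z_0}\right)\in\mathbb{R}[z_0,z_1,\dots,z_k]$$ be its homogenized blowup-polynomial. Then each of the following two conditions is equivalent to $G$ being a complete multipartite graph: (7) the polynomial $\widetilde p_G(z_0,\dots,z_k)$ is strongly log-concave; (8) the polynomial $\widetilde p_G(z_0,\dots,z_k)$ is completely log-concave.
   Context: For a finite simple connected graph $H$, its distance matrix $D_H$ is the matrix indexed by $V(H)\times V(H)$ whose $(v,w)$ entry is the length of a shortest path from $v$ to $w$ if $v\ne w$, and $0$ if $v=w$. Given a finite simple connected graph $G=(V,E)$ with $|V|\ge 2$ and positive integers $\mathbf n=\{n_v: v\in V\}$, the blowup graph $G[\mathbf n]$ is the finite simple connected graph having $n_v$ copies of each vertex $v\in V$, in which a copy of $v$ is adjacent to a copy of $w$ if and only if $v\neq w$ and $(v,w)\in E$. The blowup-polynomial of $G$ is the unique polynomial $p_G(\mathbf n)\in\mathbb{Z}[\{n_v: v\in V\}]$ (it is known to exist, and to be multi-affine, i.e. of degree at most $1$ in each variable) such that $\det D_{G[\mathbf n]}=(-2)^{\sum_{v}(n_v-1)}p_G(\mathbf n)$ for all $\mathbf n\in\mathbb{Z}_{>0}^V$; here the $n_v$ are regarded as indeterminates, enumerated as $n_1,\dots,n_k$. Let $p\in\mathbb{R}[z_1,\dots,z_m]$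 be a polynomial with non-negative coefficients (having non-negative coefficients is part of both definitions below). - $p$ is strongly log-concave if for every $\alpha\in\mathbb{Z}_{\ge 0}^m$, either the derivative $\partial^\alpha(p):=\prod_{i=1}^m\partial_{z_i}^{\alpha_i}\cdot p$ is identically zero, or $\partial^\alpha(p)>0$ and $\log(\partial^\alpha(p))$ is concave on $(0,\infty)^m$. - $p$ is completely log-concave if for all integers $r>0$ and all matrices $A=(a_{ij})\in[0,\infty)^{r\times m}$, either the derivative $\partial_A(p):=\prod_{i=1}^r\left(\sum_{j=1}^m a_{ij}\partial_{z_j}\right)\cdot p$ is identically zero, or $\partial_A(p)>0$ and $\log(\partial_A(p))$ is concave on $(0,\infty)^m$. These are applied to $\widetilde p_G$ as a polynomial in the $k+1$ variables $z_0,\dots,z_k$. *)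

theory Defs
  imports
    "Graph_Theory.Digraph_Component"
    "Graph_Theory.Pair_Digraph"
    "Jordan_Normal_Form.Determinant"
    "HOL-Library.Poly_Mapping"
    "HOL-Library.Countable_Set"
    "HOL-Library.Disjoint_Sets"
begin

section \<open>Graphs, distance matrices and blowups\<close>

text \<open>
  A finite simple graph is a \<open>pair_graph\<close>: a finite loop-free digraph whose set of arcs is a
  symmetric set of pairs of vertices.
\<close>

definition graph_dist :: "'a pair_pre_digraph \<Rightarrow> 'a \<Rightarrow> 'a \<Rightarrow> nat" where
  "graph_dist H v w = (LEAST l. \<exists>p. pre_digraph.apath (with_proj H) v p w \<and> length p = l)"

text \<open>
  Library matrices are indexed by initial segments of the natural numbers, so the vertices are
  enumerated by \<open>from_nat_into\<close>, which is a bijection from \<open>{..<card S}\<close> onto \<open>S\<close> for finite \<open>S\<close>.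
  The determinant does not depend on the enumeration.
\<close>

definition distance_matrix :: "'a pair_pre_digraph \<Rightarrow> int mat" where
  "distance_matrix H =
     mat (card (pverts H)) (card (pverts H))
       (\<lambda>(i, j). int (graph_dist H (from_nat_into (pverts H) i) (from_nat_into (pverts H) j)))"

text \<open>The copies of a vertex \<open>v\<close> are the pairs \<open>(v, i)\<close> with \<open>i < n v\<close>.\<close>

definition blowup :: "'a pair_pre_digraph \<Rightarrow> ('a \<Rightarrow> nat) \<Rightarrow> ('a \<times> nat) pair_pre_digraph" where
  "blowup G n =
     \<lparr> pverts = {(v, i). v \<in> pverts G \<and> i < n v},
       parcs = {((v, i), (w, j)). (v, w) \<in> parcs G \<and> v \<noteq> w \<and> i < n v \<and> j < n w} \<rparr>"

definition complete_multipartite :: "'a pair_pre_digraph \<Rightarrow> bool" where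
  "complete_multipartite G \<longleftrightarrow>
     (\<exists>P. partition_on (pverts G) P \<and>
          parcs G = {(v, w). v \<in> pverts G \<and> w \<in> pverts G \<and> \<not> (\<exists>B\<in>P. v \<in> B \<and> w \<in> B)})"


section \<open>Multivariate polynomials\<close>

text \<open>
  A polynomial maps each monomial, i.e. each finitely supported exponent vector, to its
  coefficient. The polynomials in the variables from \<open>S\<close> are those \<open>p\<close> with \<open>indets p \<subseteq> S\<close>; the
  values of an evaluation point outside \<open>S\<close> are then irrelevant.
\<close>

type_synonym ('v, 'b) mpoly = "('v \<Rightarrow>\<^sub>0 nat) \<Rightarrow>\<^sub>0 'b"

definition indets :: "('v, 'b::zero) mpoly \<Rightarrow> 'v set" where
  "indets p = (\<Union>m\<in>Poly_Mapping.keys p. Poly_Mapping.keys m)"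

definition mpeval :: "('v \<Rightarrow> 'b) \<Rightarrow> ('v, 'b::comm_semiring_1) mpoly \<Rightarrow> 'b" where
  "mpeval x p =
     (\<Sum>m\<in>Poly_Mapping.keys p. Poly_Mapping.lookup p m *
        (\<Prod>i\<in>Poly_Mapping.keys m. x i ^ Poly_Mapping.lookup m i))"

definition mpderiv :: "'v \<Rightarrow> ('v, 'b::comm_semiring_1) mpoly \<Rightarrow> ('v, 'b) mpoly" where
  "mpderiv i p =
     (\<Sum>m\<in>Poly_Mapping.keys p.
        Poly_Mapping.single (m - Poly_Mapping.single i 1)
          (of_nat (Poly_Mapping.lookup m i) * Poly_Mapping.lookup p m))"

lemma lookup_mpderiv:
  "Poly_Mapping.lookup (mpderiv i p) m =
     of_nat (Suc (Poly_Mapping.lookup m i)) * Poly_Mapping.lookup p (m + Poly_Mapping.single i 1)"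
proof -
  let ?e = "Poly_Mapping.single i (1::nat)"
  have *: "(of_nat (Poly_Mapping.lookup m' i) * Poly_Mapping.lookup p m' when m' - ?e = m) =
        (of_nat (Suc (Poly_Mapping.lookup m i)) * Poly_Mapping.lookup p (m + ?e)
          when m + ?e = m')" for m'
  proof (cases "Poly_Mapping.lookup m' i = 0")
    case True
    then have "m + ?e \<noteq> m'"
      by (auto simp: lookup_add)
    with True show ?thesis
      by simp
  next
    case False
    then have "m' - ?e + ?e = m'"
      by (intro poly_mapping_eqI) (auto simp: lookup_add lookup_minus lookup_single when_def)
    then have "m' - ?e = m \<longleftrightarrow> m + ?e = m'"
      by auto
    then show ?thesis
      by (auto simp: when_def lookup_add)
  qed
  have "Poly_Mapping.lookup (mpderiv i p) m =
      (\<Sum>m'\<in>Poly_Mapping.keys p.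
        of_nat (Suc (Poly_Mapping.lookup m i)) * Poly_Mapping.lookup p (m + ?e) when m + ?e = m')"
    unfolding mpderiv_def lookup_sum lookup_single * ..
  then show ?thesis
    by (simp add: when_def sum.delta' in_keys_iff)
qed

lemma mpderiv_commute: "mpderiv i (mpderiv j p) = mpderiv j (mpderiv i p)"
proof (cases "i = j")
  case False
  then show ?thesis
    by (intro poly_mapping_eqI) (simp add: lookup_mpderiv lookup_add lookup_single add_ac mult_ac)
qed simp

text \<open>The partial derivatives commute, so the order in which this fold proceeds does not matter.\<close>

definition mpderiv_multi ::
  "'v set \<Rightarrow> ('v \<Rightarrow> nat) \<Rightarrow> ('v, 'b::comm_semiring_1) mpoly \<Rightarrow> ('v, 'b) mpoly" where
  "mpderiv_multi S \<alpha> p = Finite_Set.fold (\<lambda>i. mpderiv i ^^ \<alpha> i) p S"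

lemma mpderiv_multi_empty [simp]: "mpderiv_multi {} \<alpha> p = p"
  by (simp add: mpderiv_multi_def)

lemma mpderiv_multi_insert:
  assumes "finite S" "i \<notin> S"
  shows "mpderiv_multi (insert i S) \<alpha> p = (mpderiv i ^^ \<alpha> i) (mpderiv_multi S \<alpha> p)"
proof -
  have one: "mpderiv j ((mpderiv k ^^ b) q) = (mpderiv k ^^ b) (mpderiv j q)"
    for j k b and q :: "('a, 'b) mpoly"
    by (induction b) (simp_all add: mpderiv_commute[of j k])
  have "(mpderiv j ^^ a) ((mpderiv k ^^ b) q) = (mpderiv k ^^ b) ((mpderiv j ^^ a) q)"
    for j k a b and q :: "('a, 'b) mpoly"
    by (induction a) (simp_all add: one)
  then interpret comp_fun_commute "\<lambda>i. (mpderiv i :: ('a, 'b) mpoly \<Rightarrow> _) ^^ \<alpha> i"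
    by unfold_locales (simp add: fun_eq_iff)
  show ?thesis
    using assms by (simp add: mpderiv_multi_def)
qed

definition mpderiv_dir ::
  "'v set \<Rightarrow> ('v \<Rightarrow> 'b) \<Rightarrow> ('v, 'b::comm_semiring_1) mpoly \<Rightarrow> ('v, 'b) mpoly" where
  "mpderiv_dir S a p = (\<Sum>j\<in>S. Poly_Mapping.map ((*) (a j)) (mpderiv j p))"

text \<open>The rows of the matrix \<open>A\<close> are indexed by \<open>{..<r}\<close> and its columns by \<open>S\<close>.\<close>

definition mpderiv_mat ::
  "'v set \<Rightarrow> nat \<Rightarrow> (nat \<Rightarrow> 'v \<Rightarrow> 'b) \<Rightarrow> ('v, 'b::comm_semiring_1) mpoly \<Rightarrow> ('v, 'b) mpoly" where
  "mpderiv_mat S r A p = foldr (\<lambda>i. mpderiv_dir S (A i)) [0..<r] p"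


section \<open>Log-concavity\<close>

definition orthant :: "'v set \<Rightarrow> ('v \<Rightarrow> real) set" where
  "orthant S = {x. \<forall>i\<in>S. 0 < x i}"

text \<open>
  The last conjunct is \<open>concave_on\<close> written out, because the function type \<open>'v \<Rightarrow> real\<close> is not an
  instance of \<open>real_vector\<close>.
\<close>

definition log_concave_on_orthant :: "'v set \<Rightarrow> ('v, real) mpoly \<Rightarrow> bool" where
  "log_concave_on_orthant S q \<longleftrightarrow>
     (\<forall>x\<in>orthant S. 0 < mpeval x q) \<and>
     (\<forall>x\<in>orthant S. \<forall>y\<in>orthant S. \<forall>t. 0 \<le> t \<and> t \<le> 1 \<longrightarrow>
        (1 - t) * ln (mpeval x q) + t * ln (mpeval y q)
          \<le> ln (mpeval (\<lambda>i. (1 - t) * x i + t * y i) q))"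

definition strongly_log_concave :: "'v set \<Rightarrow> ('v, real) mpoly \<Rightarrow> bool" where
  "strongly_log_concave S p \<longleftrightarrow>
     indets p \<subseteq> S \<and> (\<forall>m. 0 \<le> Poly_Mapping.lookup p m) \<and>
     (\<forall>\<alpha>. mpderiv_multi S \<alpha> p = 0 \<or> log_concave_on_orthant S (mpderiv_multi S \<alpha> p))"

definition completely_log_concave :: "'v set \<Rightarrow> ('v, real) mpoly \<Rightarrow> bool" where
  "completely_log_concave S p \<longleftrightarrow>
     indets p \<subseteq> S \<and> (\<forall>m. 0 \<le> Poly_Mapping.lookup p m) \<and>
     (\<forall>r A. 0 < r \<and> (\<forall>i<r. \<forall>j\<in>S. 0 \<le> A i j) \<longrightarrow>
        mpderiv_mat S r A p = 0 \<or> log_concave_on_orthant S (mpderiv_mat S r A p))"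


section \<open>The blowup-polynomial and its homogenization\<close>

definition blowup_polynomial :: "'a pair_pre_digraph \<Rightarrow> ('a, int) mpoly" where
  "blowup_polynomial G =
     (THE p. indets p \<subseteq> pverts G \<and>
        (\<forall>n. (\<forall>v\<in>pverts G. 0 < n v) \<longrightarrow>
           det (distance_matrix (blowup G n)) =
             (- 2) ^ (\<Sum>v\<in>pverts G. n v - 1) * mpeval (\<lambda>v. int (n v)) p))"

text \<open>
  The homogenizing variable \<open>z\<^sub>0\<close> is \<open>None\<close>, and the variable of the vertex \<open>v\<close> is \<open>Some v\<close>.
\<close>

definition hom_vars :: "'a pair_pre_digraph \<Rightarrow> 'a option set" where
  "hom_vars G = insert None (Some ` pverts G)"

text \<open>
  The defining expression is a rational function; the homogenized polynomial is the polynomial that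
  agrees with it wherever \<open>z\<^sub>0\<close> is nonzero.
\<close>

definition hom_blowup_polynomial :: "'a pair_pre_digraph \<Rightarrow> ('a option, real) mpoly" where
  "hom_blowup_polynomial G =
     (THE q. indets q \<subseteq> hom_vars G \<and>
        (\<forall>z. z None \<noteq> 0 \<longrightarrow>
           mpeval z q =
             (- z None) ^ card (pverts G) *
             mpeval (\<lambda>v. z (Some v) / (- z None))
               (Poly_Mapping.map real_of_int (blowup_polynomial G))))"

end

theory Submission
  imports
    Defs
    "HOL-Analysis.Convex"
    "HOL-Computational_Algebra.Fundamental_Theorem_Algebra"
begin

text \<open>
  Write \<open>D\<close> for the distance matrix of \<open>G\<close> and \<open>N = D + 2 I\<close>. Two copies of the same vertex have
  distance 2 in a blowup (through a copy of a neighbour), and copies of different vertices are as far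
  apart as the vertices themselves. So the distance matrix of \<open>G[n]\<close> is \<open>- 2 I\<close> plus the matrix
  \<open>N\<close> with repeated rows and columns. Expanding along the diagonal and discarding the minors with
  equal rows gives \<open>p\<^sub>G(n) = (\<Sum>J\<subseteq>V. (- 2) ^ (k - |J|) * det N\<^sub>J * (\<Prod>j\<in>J. n\<^sub>j))\<close>, where \<open>N\<^sub>J\<close> is the
  principal submatrix of \<open>N\<close> on \<open>J\<close>. Hence the homogenization has the coefficients
  \<open>2 ^ (k - |J|) * det N\<^sub>J\<close>, and it equals \<open>det (2 z\<^sub>0 I + N diag(z\<^sub>1, \<dots>, z\<^sub>k))\<close>.

  If \<open>G\<close> is not complete multipartite, then non-adjacency is not transitive: some edge \<open>uv\<close> has a
  third vertex \<open>w\<close> adjacent to neither end. The minor of \<open>N\<close> on \<open>{u, v, w}\<close> is then negative, so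
  the homogenized polynomial has a negative coefficient and neither condition can hold.

  If \<open>G\<close> is complete multipartite, then \<open>N u v\<close> is 2 for \<open>u\<close> and \<open>v\<close> in the same part, and 1
  otherwise. So \<open>N\<close> is the all-ones matrix plus the indicator of "same part", a sum of matrices
  \<open>e e\<^sup>T\<close>, and therefore positive semidefinite. This makes the determinant above nonzero when
  all variables lie in the open upper half-plane (\<open>set_det_pencil_nonzero\<close>): the homogenized
  polynomial is a stable form, that is, homogeneous, stable and with non-negative coefficients.

  Stable forms are completely log-concave, and strong log-concavity is the special case of
  derivatives along coordinate directions. Indeed, the restriction \<open>s \<mapsto> q (x + s y)\<close> of a stable form to a line
  with \<open>x\<close> and \<open>y\<close> in the positive orthant has only negative real roots, so it is a product of positive linear
  factors, whose logarithm is concave. By the argument of Gauss and Lucas, derivatives in strictly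
  positive directions preserve stable forms. Directions with zero entries are limits of strictly
  positive ones, and the inequality of log-concavity passes to the limit. Approximating only in this
  last step avoids a discussion of when a derivative of a stable polynomial vanishes identically.
\<close>

section \<open>Determinants indexed by finite sets\<close>

text \<open>
  Indexing by arbitrary finite sets makes principal minors of matrices whose rows are
  vertices available without choosing enumerations.
\<close>

definition set_det :: "'a set \<Rightarrow> ('a \<Rightarrow> 'a \<Rightarrow> 'b::comm_ring_1) \<Rightarrow> 'b" where
  "set_det S f = (\<Sum>p | p permutes S. of_int (sign p) * (\<Prod>i\<in>S. f i (p i)))"

lemma set_det_cong:
  assumes "\<And>i j. i \<in> S \<Longrightarrow> j \<in> S \<Longrightarrow> f i j = g i j"
  shows "set_det S f = set_det S g"
  unfolding set_det_def
  by (intro sum.cong refl arg_cong2[where f = "(*)"] prod.cong assms)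
    (auto simp: permutes_in_image)

lemma of_int_set_det: "of_int (set_det S f) = set_det S (\<lambda>i j. of_int (f i j))"
  by (simp add: set_det_def)

text \<open>
  Conjugation by \<open>g\<close> is a sign-preserving bijection between the permutations of \<open>S\<close> and of \<open>g ` S\<close>.
\<close>

lemma set_det_image:
  fixes f :: "'b \<Rightarrow> 'b \<Rightarrow> 'c::comm_ring_1"
  assumes "finite S" "inj_on g S"
  shows "set_det (g ` S) f = set_det S (\<lambda>i j. f (g i) (g j))"
proof -
  have bij: "bij_betw g S (g ` S)" "bij_betw (inv_into S g) (g ` S) S"
    using assms by (simp_all add: bij_betw_def inj_on_inv_into)
  have 1: "bij_betw (map_permutation S g) {p. p permutes S} {p. p permutes g ` S}"
  proof (rule bij_betw_byWitness[where f' = "map_permutation (g ` S) (inv_into S g)"])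
    show "\<forall>p\<in>{p. p permutes S}. map_permutation (g ` S) (inv_into S g) (map_permutation S g p) = p"
      by (auto intro!: map_permutation_compose_inv[OF bij(1)] simp: assms)
    show "\<forall>p\<in>{p. p permutes g ` S}. map_permutation S g (map_permutation (g ` S) (inv_into S g) p) = p"
      by (auto intro!: map_permutation_compose_inv[OF bij(2)] simp: f_inv_into_f)
  qed (use bij map_permutation_permutes in blast)+
  have "set_det (g ` S) f =
      (\<Sum>p | p permutes S. of_int (sign (map_permutation S g p)) *
         (\<Prod>i\<in>g ` S. f i (map_permutation S g p i)))"
    unfolding set_det_def by (rule sum.reindex_bij_betw[OF 1, symmetric])
  also have "\<dots> = set_det S (\<lambda>i j. f (g i) (g j))"
    unfolding set_det_def
    by (intro sum.cong refl)
      (use assms in \<open>auto simp: sign_map_permutation prod.reindex map_permutation_apply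
         intro!: arg_cong2[where f = "(*)"] prod.cong\<close>)
  finally show ?thesis .
qed

lemma det_mat_enumeration:
  assumes "bij_betw g {..<n} S"
  shows "det (mat n n (\<lambda>(i, j). f (g i) (g j))) = set_det S f"
proof -
  have "set_det S f = set_det {..<n} (\<lambda>i j. f (g i) (g j))"
    using assms set_det_image[of "{..<n}" g f] by (auto simp: bij_betw_def)
  also have "\<dots> = det (mat n n (\<lambda>(i, j). f (g i) (g j)))"
    unfolding set_det_def det_def
    by (auto intro!: sum.cong prod.cong arg_cong2[where f = "(*)"]
        simp: atLeast0LessThan permutes_in_image)
  finally show ?thesis ..
qed

lemma set_det_equal_rows:
  assumes "finite S" "a \<in> S" "b \<in> S" "a \<noteq> b" "\<And>j. j \<in> S \<Longrightarrow> f a j = f b j"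
  shows "set_det S f = 0"
proof -
  obtain g where g: "bij_betw g {..<card S} S"
    using ex_bij_betw_nat_finite[OF assms(1)] by (auto simp: atLeast0LessThan)
  have "a \<in> g ` {..<card S}" "b \<in> g ` {..<card S}"
    using g assms(2,3) by (simp_all add: bij_betw_def)
  then obtain i j where ij: "i < card S" "j < card S" "g i = a" "g j = b"
    by auto
  have "g l \<in> S" if "l < card S" for l
    using g that by (auto simp: bij_betw_def)
  then have "det (mat (card S) (card S) (\<lambda>(i, j). f (g i) (g j))) = 0"
    by (intro det_identical_rows[of _ "card S" i j]) (use ij assms in auto)
  then show ?thesis
    by (simp add: det_mat_enumeration[OF g])
qed

lemma set_det_scale_columns:
  assumes "finite S"
  shows "set_det S (\<lambda>i j. f i j * z j) = prod z S * set_det S f"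
  unfolding set_det_def sum_distrib_left
proof (intro sum.cong refl)
  fix p assume "p \<in> {p. p permutes S}"
  then have "(\<Prod>i\<in>S. z (p i)) = prod z S"
    by (simp add: prod.permute[of p S z] o_def)
  then show "of_int (sign p) * (\<Prod>i\<in>S. f i (p i) * z (p i)) =
      prod z S * (of_int (sign p) * (\<Prod>i\<in>S. f i (p i)))"
    by (simp add: prod.distrib algebra_simps)
qed

text \<open>
  Multiplying out the product for a permutation \<open>p\<close>, the factors outside \<open>T\<close> come from the diagonal
  term. They vanish unless \<open>p\<close> fixes every point outside \<open>T\<close>, that is, unless \<open>p\<close> permutes \<open>T\<close>.
\<close>

lemma set_det_add_diagonal:
  assumes "finite S"
  shows "set_det S (\<lambda>i j. f i j + (if i = j then c else 0)) =
    (\<Sum>T\<in>Pow S. c ^ card (S - T) * set_det T f)"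
proof -
  let ?t = "\<lambda>p T. of_int (sign p) * (\<Prod>i\<in>T. f i (p i))"
  have *: "(\<Prod>i\<in>S - T. if i = p i then c else 0) = (if p permutes T then c ^ card (S - T) else 0)"
    if "T \<subseteq> S" "p permutes S" for p T
  proof (cases "\<forall>i\<in>S - T. p i = i")
    case True
    then have "p permutes T"
      using that by (intro permutes_superset[OF that(2)]) auto
    then show ?thesis using True by simp
  next
    case False
    then have "\<not> p permutes T"
      by (auto simp: permutes_def)
    moreover obtain i where i: "i \<in> S - T" "p i \<noteq> i"
      using False by blast
    then have "(\<Prod>i\<in>S - T. if i = p i then c else 0) = 0"
      using assms by (intro prod_zero bexI[of _ i]) auto
    ultimately show ?thesis by simp
  qed
  have "set_det S (\<lambda>i j. f i j + (if i = j then c else 0)) =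
     (\<Sum>p | p permutes S. \<Sum>T\<in>Pow S. of_int (sign p) *
        ((\<Prod>i\<in>T. f i (p i)) * (\<Prod>i\<in>S - T. if i = p i then c else 0)))"
    unfolding set_det_def by (simp add: prod_add[OF assms] sum_distrib_left)
  also have "\<dots> = (\<Sum>T\<in>Pow S. \<Sum>p | p permutes S. if p permutes T then c ^ card (S - T) * ?t p T else 0)"
    by (subst sum.swap, intro sum.cong refl) (auto simp: *)
  also have "\<dots> = (\<Sum>T\<in>Pow S. \<Sum>p | p permutes T. c ^ card (S - T) * ?t p T)"
  proof (rule sum.cong[OF refl])
    fix T assume "T \<in> Pow S"
    then have "{p. p permutes T} \<subseteq> {p. p permutes S}"
      by (auto intro: permutes_subset)
    then show "(\<Sum>p | p permutes S. if p permutes T then c ^ card (S - T) * ?t p T else 0) =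
      (\<Sum>p | p permutes T. c ^ card (S - T) * ?t p T)"
      using finite_permutations[OF assms] by (intro sum.mono_neutral_cong_right) auto
  qed
  finally show ?thesis
    by (simp add: set_det_def sum_distrib_left)
qed

lemma set_det_eq_0_kernel:
  fixes f :: "'a \<Rightarrow> 'a \<Rightarrow> 'b::idom"
  assumes "finite S" "set_det S f = 0"
  shows "\<exists>v. (\<exists>i\<in>S. v i \<noteq> 0) \<and> (\<forall>i\<in>S. (\<Sum>j\<in>S. f i j * v j) = 0)"
proof -
  define n where "n = card S"
  obtain g where g: "bij_betw g {..<n} S"
    using ex_bij_betw_nat_finite[OF assms(1)] by (auto simp: atLeast0LessThan n_def)
  define A where "A = mat n n (\<lambda>(i, j). f (g i) (g j))"
  have A: "A \<in> carrier_mat n n"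
    by (simp add: A_def)
  have "det A = 0"
    using det_mat_enumeration[OF g, of f] assms by (simp add: A_def)
  then obtain v where v: "v \<in> carrier_vec n" "v \<noteq> 0\<^sub>v n" "A *\<^sub>v v = 0\<^sub>v n"
    using det_0_iff_vec_prod_zero[OF A] by blast
  define h where "h = the_inv_into {..<n} g"
  have hg: "h (g i) = i" if "i < n" for i
    using g that by (simp add: h_def the_inv_into_f_f bij_betw_def)
  obtain i0 where i0: "i0 < n" "v $ i0 \<noteq> 0"
    using v by (auto simp: vec_eq_iff)
  show ?thesis
  proof (intro exI[of _ "\<lambda>i. v $ h i"] conjI ballI)
    show "\<exists>i\<in>S. v $ h i \<noteq> 0"
      using i0 g by (intro bexI[of _ "g i0"]) (auto simp: hg bij_betw_def)
  next
    fix i assume "i \<in> S"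
    then obtain l where l: "l < n" "i = g l"
      using g by (auto simp: bij_betw_def)
    have "(\<Sum>j\<in>S. f i j * v $ h j) = (\<Sum>m<n. f (g l) (g m) * v $ m)"
      unfolding l by (subst sum.reindex_bij_betw[OF g, symmetric]) (simp add: hg)
    also have "\<dots> = (A *\<^sub>v v) $ l"
      using l v(1) by (simp add: A_def scalar_prod_def atLeast0LessThan)
    finally show "(\<Sum>j\<in>S. f i j * v $ h j) = 0"
      using l v(3) by simp
  qed
qed

lemma set_det_3:
  fixes f :: "'a \<Rightarrow> 'a \<Rightarrow> 'b::comm_ring_1"
  assumes "a \<noteq> b" "a \<noteq> c" "b \<noteq> c"
  shows "set_det {a, b, c} f =
    f a a * f b b * f c c - f a a * f b c * f c b - f a b * f b a * f c c
    + f a b * f b c * f c a + f a c * f b a * f c b - f a c * f b b * f c a"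
proof -
  have f: "finite {b, c}" "a \<notin> {b, c}" "finite {c}" "b \<notin> {c}"
    using assms by auto
  show ?thesis
    unfolding set_det_def sum_over_permutations_insert[OF f(1,2)]
      sum_over_permutations_insert[OF f(3,4)] permutes_sing
    using assms
    by (simp add: sign_swap_id permutation_swap_id sign_compose algebra_simps transpose_def)
qed

text \<open>
  In the diagonal expansion a minor vanishes as soon as it contains two copies of the same vertex.
  The others are minors of \<open>f\<close> itself, and the one on \<open>J\<close> occurs once for each choice of a copy of
  every vertex in \<open>J\<close>.
\<close>

lemma set_det_blowup:
  fixes f :: "'a \<Rightarrow> 'a \<Rightarrow> 'b::comm_ring_1" and n :: "'a \<Rightarrow> nat"
  assumes V: "finite V"
  defines "K \<equiv> Sigma V (\<lambda>v. {..<n v})"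
  shows "set_det K (\<lambda>x y. f (fst x) (fst y) + (if x = y then c else 0)) =
    (\<Sum>J\<in>Pow V. of_nat (\<Prod>j\<in>J. n j) * c ^ (card K - card J) * set_det J f)"
proof -
  let ?F = "\<lambda>x y. f (fst x) (fst y)"
  define C where "C J = {T. T \<subseteq> K \<and> inj_on fst T \<and> fst ` T = J}" for J
  have K: "finite K"
    using V by (auto simp: K_def)
  have C: "card (C J) = (\<Prod>j\<in>J. n j)" if "J \<subseteq> V" for J
  proof -
    have J: "finite J"
      using that V by (rule finite_subset)
    have "bij_betw (\<lambda>\<phi>. (\<lambda>j. (j, \<phi> j)) ` J) (PiE J (\<lambda>j. {..<n j})) (C J)"
      unfolding bij_betw_def
    proof (intro conjI inj_onI)
      fix \<phi> \<psi> assume *: "\<phi> \<in> PiE J (\<lambda>j. {..<n j})" "\<psi> \<in> PiE J (\<lambda>j. {..<n j})"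
        "(\<lambda>j. (j, \<phi> j)) ` J = (\<lambda>j. (j, \<psi> j)) ` J"
      show "\<phi> = \<psi>"
      proof (rule PiE_ext[OF *(1,2)])
        fix j assume "j \<in> J"
        then have "(j, \<phi> j) \<in> (\<lambda>j. (j, \<psi> j)) ` J"
          using *(3) by blast
        then show "\<phi> j = \<psi> j"
          by auto
      qed
    next
      show "(\<lambda>\<phi>. (\<lambda>j. (j, \<phi> j)) ` J) ` (PiE J (\<lambda>j. {..<n j})) = C J"
      proof (intro equalityI subsetI)
        fix T assume "T \<in> (\<lambda>\<phi>. (\<lambda>j. (j, \<phi> j)) ` J) ` (PiE J (\<lambda>j. {..<n j}))"
        then obtain \<phi> where \<phi>: "\<phi> \<in> PiE J (\<lambda>j. {..<n j})" and T: "T = (\<lambda>j. (j, \<phi> j)) ` J"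
          by blast
        then show "T \<in> C J"
          using that by (auto simp: C_def K_def inj_on_def image_image)
      next
        fix T assume T: "T \<in> C J"
        define \<phi> where "\<phi> = (\<lambda>j\<in>J. snd (the_inv_into T fst j))"
        have inv: "the_inv_into T fst (fst x) = x" if "x \<in> T" for x
          using T that by (intro the_inv_into_f_f) (auto simp: C_def)
        then have \<phi>: "\<phi> (fst x) = snd x" if "x \<in> T" for x
          using T that by (auto simp: \<phi>_def C_def)
        have "T = (\<lambda>x. (fst x, \<phi> (fst x))) ` T"
          by (simp add: \<phi> cong: image_cong_simp)
        also have "\<dots> = (\<lambda>j. (j, \<phi> j)) ` fst ` T"
          by (simp only: image_image)
        finally have "T = (\<lambda>j. (j, \<phi> j)) ` J"
          using T unfolding C_def by simp
        moreover have "\<phi> j \<in> {..<n j}" if "j \<in> J" for j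
        proof -
          have "j \<in> fst ` T"
            using T that by (simp add: C_def)
          then obtain x where x: "x \<in> T" "j = fst x"
            by blast
          then have "x \<in> K"
            using T by (auto simp: C_def)
          then show ?thesis
            using x \<phi>[OF x(1)] by (auto simp: K_def)
        qed
        then have "\<phi> \<in> PiE J (\<lambda>j. {..<n j})"
          by (auto simp: \<phi>_def)
        ultimately show "T \<in> (\<lambda>\<phi>. (\<lambda>j. (j, \<phi> j)) ` J) ` (PiE J (\<lambda>j. {..<n j}))"
          by blast
      qed
    qed
    then show ?thesis
      using J by (simp add: bij_betw_same_card[symmetric] card_PiE)
  qed
  have "set_det K (\<lambda>x y. ?F x y + (if x = y then c else 0)) =
      (\<Sum>T\<in>Pow K. c ^ card (K - T) * set_det T ?F)"
    by (rule set_det_add_diagonal[OF K])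
  also have "\<dots> = (\<Sum>T\<in>{T \<in> Pow K. inj_on fst T}. c ^ card (K - T) * set_det T ?F)"
  proof (intro sum.mono_neutral_right ballI)
    fix T assume T: "T \<in> Pow K - {T \<in> Pow K. inj_on fst T}"
    then obtain x y where "x \<in> T" "y \<in> T" "x \<noteq> y" "fst x = fst y"
      by (auto simp: inj_on_def)
    moreover have "finite T"
      using T K by (auto intro: finite_subset)
    ultimately have "set_det T ?F = 0"
      by (intro set_det_equal_rows[of T x y]) auto
    then show "c ^ card (K - T) * set_det T ?F = 0"
      by simp
  qed (use K in auto)
  also have "\<dots> = (\<Sum>J\<in>Pow V. \<Sum>T\<in>{T \<in> {T \<in> Pow K. inj_on fst T}. fst ` T = J}.
       c ^ card (K - T) * set_det T ?F)"
    by (rule sum.group[symmetric]) (use K V in \<open>auto simp: K_def\<close>)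
  also have "\<dots> = (\<Sum>J\<in>Pow V. \<Sum>T\<in>C J. c ^ (card K - card J) * set_det J f)"
  proof (intro sum.cong)
    fix J T assume T: "T \<in> C J"
    then have fT: "finite T"
      using K by (auto simp: C_def intro: finite_subset)
    have "card (K - T) = card K - card J"
      using T fT by (auto simp: C_def card_Diff_subset card_image)
    moreover have "set_det T ?F = set_det J f"
      using set_det_image[OF fT, of fst f] T by (simp add: C_def)
    ultimately show "c ^ card (K - T) * set_det T ?F = c ^ (card K - card J) * set_det J f"
      by simp
  qed (auto simp: C_def)
  also have "\<dots> = (\<Sum>J\<in>Pow V. of_nat (\<Prod>j\<in>J. n j) * c ^ (card K - card J) * set_det J f)"
    by (intro sum.cong) (auto simp: C mult.assoc)
  finally show ?thesis .
qed

text \<open>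
  The determinant vanishes once there are two equal rows, and it is 1 in the remaining cases.
\<close>

lemma set_det_all_ones_nonneg:
  assumes "finite T"
  shows "0 \<le> set_det T (\<lambda>_ _. 1::int)"
proof (cases "\<exists>a\<in>T. \<exists>b\<in>T. a \<noteq> b")
  case True
  then show ?thesis
    using set_det_equal_rows[OF assms, of _ _ "\<lambda>_ _. 1::int"] by (metis order.refl)
next
  case False
  then have "T = {} \<or> (\<exists>a. T = {a})"
    by blast
  then show ?thesis
    by (auto simp: set_det_def permutes_sing)
qed

text \<open>
  For \<open>v\<close> in the kernel, put \<open>w x = z x * v x\<close>. Pairing the equation \<open>f w + u (w / z) = 0\<close> with
  \<open>w\<close> and dividing by \<open>u\<close> gives \<open>(w\<^sup>* f w) / u + (\<Sum>x. \<bar>w x\<bar>\<^sup>2 / z x) = 0\<close>. As \<open>u\<close> and all \<open>z x\<close> lie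
  in the upper half-plane, their inverses lie in the lower one, and since \<open>w\<^sup>* f w \<ge> 0\<close> the
  left-hand side has negative imaginary part unless \<open>w = 0\<close>.
\<close>

lemma set_det_pencil_nonzero:
  fixes f :: "'a \<Rightarrow> 'a \<Rightarrow> complex"
  assumes S: "finite S"
    and psd: "\<And>w. \<exists>R\<ge>0. (\<Sum>x\<in>S. \<Sum>y\<in>S. cnj (w x) * f x y * w y) = of_real R"
    and u: "0 < Im u" and z: "\<And>x. x \<in> S \<Longrightarrow> 0 < Im (z x)"
  shows "set_det S (\<lambda>x y. f x y * z y + (if x = y then u else 0)) \<noteq> 0"
proof
  assume "set_det S (\<lambda>x y. f x y * z y + (if x = y then u else 0)) = 0"
  then obtain v where v: "\<exists>x\<in>S. v x \<noteq> 0"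
    "\<And>x. x \<in> S \<Longrightarrow> (\<Sum>y\<in>S. (f x y * z y + (if x = y then u else 0)) * v y) = 0"
    using set_det_eq_0_kernel[OF S] by blast
  define w where "w y = z y * v y" for y
  have z0: "z x \<noteq> 0" if "x \<in> S" for x
    using z[OF that] by auto
  have u0: "u \<noteq> 0"
    using u by auto
  have row: "(\<Sum>y\<in>S. f x y * w y) = - u * (w x / z x)" if "x \<in> S" for x
  proof -
    have "(\<Sum>y\<in>S. (f x y * z y + (if x = y then u else 0)) * v y) =
        (\<Sum>y\<in>S. f x y * w y) + (\<Sum>y\<in>S. if x = y then u * v y else 0)"
      unfolding sum.distrib[symmetric] by (intro sum.cong refl) (simp add: w_def algebra_simps)
    also have "(\<Sum>y\<in>S. if x = y then u * v y else 0) = u * (w x / z x)"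
      using S that z0[OF that] by (simp add: w_def)
    finally show ?thesis
      using v(2)[OF that] by (simp add: eq_neg_iff_add_eq_0)
  qed
  obtain R where R: "0 \<le> R" "(\<Sum>x\<in>S. \<Sum>y\<in>S. cnj (w x) * f x y * w y) = of_real R"
    using psd by blast
  have "of_real R = (\<Sum>x\<in>S. cnj (w x) * (\<Sum>y\<in>S. f x y * w y))"
    by (simp add: sum_distrib_left mult.assoc flip: R(2))
  also have "\<dots> = (\<Sum>x\<in>S. - u * (of_real ((cmod (w x))\<^sup>2) / z x))"
  proof (rule sum.cong[OF refl])
    fix x assume "x \<in> S"
    then show "cnj (w x) * (\<Sum>y\<in>S. f x y * w y) = - u * (of_real ((cmod (w x))\<^sup>2) / z x)"
      unfolding complex_norm_square by (simp only: row) simp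
  qed
  finally have "of_real R = - u * (\<Sum>x\<in>S. of_real ((cmod (w x))\<^sup>2) / z x)"
    by (simp only: sum_distrib_left)
  then have eq: "of_real R / u + (\<Sum>x\<in>S. of_real ((cmod (w x))\<^sup>2) / z x) = 0"
    using u0 by simp
  have Im: "Im (of_real r / c) = - (r * Im c / (cmod c)\<^sup>2)" for r c
    by (simp add: Im_divide cmod_power2)
  have neg: "Im (of_real ((cmod (w x))\<^sup>2) / z x) \<le> 0" if "x \<in> S" for x
    unfolding Im using z[OF that] by simp
  obtain x where x: "x \<in> S" "v x \<noteq> 0"
    using v(1) by blast
  then have "w x \<noteq> 0"
    using z0 by (simp add: w_def)
  then have "Im (of_real ((cmod (w x))\<^sup>2) / z x) < 0"
    unfolding Im using z[OF x(1)] z0[OF x(1)] by simp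
  then have "(\<Sum>x\<in>S. Im (of_real ((cmod (w x))\<^sup>2) / z x)) < 0"
    using sum_strict_mono_ex1[OF S, of "\<lambda>x. Im (of_real ((cmod (w x))\<^sup>2) / z x)" "\<lambda>_. 0"] neg x(1)
    by auto
  moreover have "Im (of_real R / u) \<le> 0"
    unfolding Im using u R(1) by simp
  ultimately have "Im (of_real R / u + (\<Sum>x\<in>S. of_real ((cmod (w x))\<^sup>2) / z x)) < 0"
    by (simp add: Im_sum)
  then show False
    unfolding eq by simp
qed

section \<open>Evaluating multivariate polynomials\<close>

definition monom_eval :: "('v \<Rightarrow> 'b) \<Rightarrow> ('v \<Rightarrow>\<^sub>0 nat) \<Rightarrow> 'b::comm_semiring_1" where
  "monom_eval x m = (\<Prod>i\<in>Poly_Mapping.keys m. x i ^ Poly_Mapping.lookup m i)"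

text \<open>
  Evaluation with the coefficients transported along \<open>h\<close>. Real polynomials are evaluated at real
  points, at complex points, and at linear polynomials in one variable; these are all instances.
\<close>

definition eval_with :: "('c \<Rightarrow> 'b) \<Rightarrow> ('v \<Rightarrow> 'b) \<Rightarrow> ('v, 'c::zero) mpoly \<Rightarrow> 'b::comm_semiring_1" where
  "eval_with h x p =
     (\<Sum>m\<in>Poly_Mapping.keys p. h (Poly_Mapping.lookup p m) * monom_eval x m)"

lemma mpeval_eq_eval_with: "mpeval x p = eval_with (\<lambda>c. c) x p"
  by (simp add: mpeval_def eval_with_def monom_eval_def)

lemma mpeval_map:
  fixes h :: "'c::comm_semiring_1 \<Rightarrow> 'b::comm_semiring_1"
  assumes "h 0 = 0" "\<And>c. h c = 0 \<Longrightarrow> c = 0"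
  shows "mpeval x (Poly_Mapping.map h p) = eval_with h x p"
proof -
  have "Poly_Mapping.keys (Poly_Mapping.map h p) = Poly_Mapping.keys p"
    using assms by (auto simp: in_keys_iff map.rep_eq when_def)
  then show ?thesis
    using assms by (simp add: mpeval_def eval_with_def monom_eval_def map.rep_eq when_def in_keys_iff)
qed

lemma monom_eval_superset:
  assumes "finite S" "Poly_Mapping.keys m \<subseteq> S"
  shows "monom_eval x m = (\<Prod>i\<in>S. x i ^ Poly_Mapping.lookup m i)"
  unfolding monom_eval_def
  by (rule prod.mono_neutral_left) (use assms in \<open>auto simp: in_keys_iff\<close>)

lemma eval_with_superset:
  assumes "finite M" "Poly_Mapping.keys p \<subseteq> M" "h 0 = 0"
  shows "eval_with h x p = (\<Sum>m\<in>M. h (Poly_Mapping.lookup p m) * monom_eval x m)"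
  unfolding eval_with_def
  by (rule sum.mono_neutral_left) (use assms in \<open>auto simp: in_keys_iff\<close>)

lemma eval_with_0 [simp]: "eval_with h x 0 = 0"
  by (simp add: eval_with_def)

lemma eval_with_single [simp]:
  "h 0 = 0 \<Longrightarrow> eval_with h x (Poly_Mapping.single m c) = h c * monom_eval x m"
  by (auto simp: eval_with_def keys_single)

lemma eval_with_add:
  fixes p q :: "('v, 'c::monoid_add) mpoly"
  assumes "h 0 = 0" "\<And>a b. h (a + b) = h a + h b"
  shows "eval_with h x (p + q) = eval_with h x p + eval_with h x q"
proof -
  let ?M = "Poly_Mapping.keys p \<union> Poly_Mapping.keys q"
  have "Poly_Mapping.keys (p + q) \<subseteq> ?M"
    by (rule Poly_Mapping.keys_add)
  then show ?thesis
    using assms by (simp add: eval_with_superset[of ?M] lookup_add algebra_simps sum.distrib)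
qed

lemma eval_with_sum:
  fixes p :: "'i \<Rightarrow> ('v, 'c::comm_monoid_add) mpoly"
  assumes "h 0 = 0" "\<And>a b. h (a + b) = h a + h b"
  shows "eval_with h x (\<Sum>i\<in>I. p i) = (\<Sum>i\<in>I. eval_with h x (p i))"
  by (induction I rule: infinite_finite_induct) (simp_all add: eval_with_add assms)

lemma eval_with_scale:
  fixes p :: "('v, 'c::comm_semiring_1) mpoly"
  assumes "h 0 = 0" "\<And>a b. h (a * b) = h a * h b"
  shows "eval_with h x (Poly_Mapping.map ((*) c) p) = h c * eval_with h x p"
proof -
  have "Poly_Mapping.keys (Poly_Mapping.map ((*) c) p) \<subseteq> Poly_Mapping.keys p"
    by (auto simp: in_keys_iff map.rep_eq when_def)
  then show ?thesis
    using assms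
    by (auto simp: eval_with_superset[of "Poly_Mapping.keys p"] map.rep_eq when_def
        sum_distrib_left mult.assoc in_keys_iff intro!: sum.cong)
qed

lemma mpeval_diff:
  fixes p q :: "('v, 'b::comm_ring_1) mpoly"
  shows "mpeval x (p - q) = mpeval x p - mpeval x q"
proof -
  have "mpeval x p = mpeval x (p - q) + mpeval x q"
    unfolding mpeval_eq_eval_with by (subst eval_with_add[symmetric]) auto
  then show ?thesis by simp
qed

lemma finite_indets [simp]: "finite (indets p)"
  by (simp add: indets_def)

lemma keys_subset_indets: "m \<in> Poly_Mapping.keys p \<Longrightarrow> Poly_Mapping.keys m \<subseteq> indets p"
  by (auto simp: indets_def)

text \<open>
  Induction on the variables: for fixed values of the variables other than \<open>v\<close>, the sum is a
  polynomial in \<open>v\<close> with infinitely many zeros, so each of its coefficients vanishes. These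
  coefficients are sums of the same kind without \<open>v\<close>. The monomials in \<open>M\<close> are required to differ on
  \<open>S\<close> rather than to be supported in \<open>S\<close>, as the exponent of \<open>v\<close> is constant, but not
  necessarily zero, on the sets to which the induction hypothesis is applied.
\<close>

lemma monomials_independent:
  fixes c :: "('v \<Rightarrow>\<^sub>0 nat) \<Rightarrow> 'b::{idom, ring_char_0}"
  assumes "finite S" "finite M"
    and "\<And>m m'. m \<in> M \<Longrightarrow> m' \<in> M \<Longrightarrow>
      (\<And>i. i \<in> S \<Longrightarrow> Poly_Mapping.lookup m i = Poly_Mapping.lookup m' i) \<Longrightarrow> m = m'"
    and "\<And>n::'v \<Rightarrow> nat. (\<And>i. 0 < n i) \<Longrightarrow>
      (\<Sum>m\<in>M. c m * (\<Prod>i\<in>S. of_nat (n i) ^ Poly_Mapping.lookup m i)) = 0"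
    and "m \<in> M"
  shows "c m = 0"
  using assms
proof (induction S arbitrary: M m)
  case empty
  then have "M = {m}"
    by auto
  then show ?case
    using empty.prems(3)[of "\<lambda>_. 1"] by simp
next
  case (insert v S)
  let ?l = Poly_Mapping.lookup
  let ?M = "\<lambda>e. {m \<in> M. ?l m v = e}"
  have *: "(\<Sum>m\<in>?M e. c m * (\<Prod>i\<in>S. of_nat (n i) ^ ?l m i)) = 0"
    if n: "\<And>i. 0 < n i" for n e
  proof -
    define P where "P = (\<Sum>m\<in>M. Polynomial.monom (c m * (\<Prod>i\<in>S. of_nat (n i) ^ ?l m i)) (?l m v))"
    have "poly P (of_nat (Suc k)) = 0" for k
    proof -
      have "(\<Prod>i\<in>S. of_nat ((n(v := Suc k)) i) ^ ?l m i) = (\<Prod>i\<in>S. (of_nat (n i) :: 'b) ^ ?l m i)" for m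
        using insert.hyps(2) by (intro prod.cong) auto
      then have "(\<Sum>m\<in>M. c m * (\<Prod>i\<in>insert v S. of_nat ((n(v := Suc k)) i) ^ ?l m i)) =
          poly P (of_nat (Suc k))"
        using insert.hyps
        by (simp add: P_def poly_sum poly_monom mult_ac del: of_nat_Suc)
      then show ?thesis
        using insert.prems(3)[of "n(v := Suc k)"] n by simp
    qed
    then have "range (\<lambda>k. of_nat (Suc k) :: 'b) \<subseteq> {x. poly P x = 0}"
      by blast
    moreover have "infinite (range (\<lambda>k. of_nat (Suc k) :: 'b))"
      by (intro range_inj_infinite) (simp add: inj_on_def del: of_nat_Suc)
    ultimately have "P = 0"
      using poly_roots_finite finite_subset by blast
    then have "0 = coeff P e"
      by simp
    also have "\<dots> = (\<Sum>m\<in>M. if ?l m v = e then c m * (\<Prod>i\<in>S. of_nat (n i) ^ ?l m i) else 0)"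
      by (simp add: P_def coeff_sum)
    finally show ?thesis
      using insert.prems(1) by (simp add: sum.inter_filter)
  qed
  show ?case
  proof (rule insert.IH[of "?M (?l m v)"])
    show "m1 = m2" if "m1 \<in> ?M (?l m v)" "m2 \<in> ?M (?l m v)" "\<And>i. i \<in> S \<Longrightarrow> ?l m1 i = ?l m2 i" for m1 m2
      using that by (intro insert.prems(2)) auto
  qed (use insert.prems * in auto)
qed

text \<open>
  Both the blowup-polynomial and its homogenization are specified by values that include those at
  all points with positive integer coordinates, so this gives uniqueness for both.
\<close>

lemma mpoly_eqI_on_positive_integers:
  fixes p q :: "('v, 'b::{idom, ring_char_0}) mpoly"
  assumes "\<And>n::'v \<Rightarrow> nat. (\<And>i. 0 < n i) \<Longrightarrow>
    mpeval (\<lambda>i. of_nat (n i)) p = mpeval (\<lambda>i. of_nat (n i)) q"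
  shows "p = q"
proof -
  let ?d = "p - q"
  have "Poly_Mapping.lookup ?d m = 0" if m: "m \<in> Poly_Mapping.keys ?d" for m
  proof (rule monomials_independent[of "indets ?d" "Poly_Mapping.keys ?d"])
    fix m1 m2 assume *: "m1 \<in> Poly_Mapping.keys ?d" "m2 \<in> Poly_Mapping.keys ?d"
      "\<And>i. i \<in> indets ?d \<Longrightarrow> Poly_Mapping.lookup m1 i = Poly_Mapping.lookup m2 i"
    show "m1 = m2"
    proof (rule poly_mapping_eqI)
      fix i
      show "Poly_Mapping.lookup m1 i = Poly_Mapping.lookup m2 i"
      proof (cases "i \<in> indets ?d")
        case False
        then have "i \<notin> Poly_Mapping.keys m1" "i \<notin> Poly_Mapping.keys m2"
          using *(1,2) keys_subset_indets by blast+
        then show ?thesis by (simp add: in_keys_iff)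
      qed (rule *(3))
    qed
  next
    fix n :: "'v \<Rightarrow> nat" assume "\<And>i. 0 < n i"
    then have "mpeval (\<lambda>i. of_nat (n i)) ?d = (0::'b)"
      using assms by (simp add: mpeval_diff)
    then show "(\<Sum>m\<in>Poly_Mapping.keys ?d. Poly_Mapping.lookup ?d m *
        (\<Prod>i\<in>indets ?d. of_nat (n i) ^ Poly_Mapping.lookup m i)) = 0"
      by (simp add: mpeval_eq_eval_with eval_with_def monom_eval_superset[OF finite_indets keys_subset_indets]
          cong: sum.cong)
  qed (use m in auto)
  then have "?d = 0"
    by (metis in_keys_iff keys_eq_empty ex_in_conv)
  then show ?thesis by simp
qed

lemma keys_sum_single:
  assumes "m \<in> Poly_Mapping.keys (\<Sum>i\<in>I. Poly_Mapping.single (f i) (c i))"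
  obtains i where "i \<in> I" "m = f i"
proof -
  have "(\<Sum>i\<in>I. Poly_Mapping.lookup (Poly_Mapping.single (f i) (c i)) m) \<noteq> 0"
    using assms by (simp add: in_keys_iff lookup_sum)
  then obtain i where "i \<in> I" "Poly_Mapping.lookup (Poly_Mapping.single (f i) (c i)) m \<noteq> 0"
    by (meson sum.neutral)
  then show thesis
    using that by (auto simp: lookup_single when_def split: if_splits)
qed

section \<open>Log-concavity of stable forms\<close>

lemma mpeval_pos:
  fixes q :: "('v, real) mpoly"
  assumes "\<And>m. 0 \<le> Poly_Mapping.lookup q m" "q \<noteq> 0" "indets q \<subseteq> S" "x \<in> orthant S"
  shows "0 < mpeval x q"
proof -
  have pos: "0 < monom_eval x m" if "m \<in> Poly_Mapping.keys q" for m
    using that assms(3,4) keys_subset_indets[OF that]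
    unfolding monom_eval_def orthant_def by (intro prod_pos) auto
  have "Poly_Mapping.lookup q m * monom_eval x m > 0" if "m \<in> Poly_Mapping.keys q" for m
    using assms(1)[of m] that pos[OF that] by (simp add: in_keys_iff less_le)
  then show ?thesis
    unfolding mpeval_eq_eval_with eval_with_def using assms(2)
    by (intro sum_pos) auto
qed

lemma eval_with_of_real_real: 
  "eval_with of_real (\<lambda>i. of_real (x i)) q = (of_real (mpeval x q) :: complex)"
  by (simp add: mpeval_eq_eval_with eval_with_def monom_eval_def)

text \<open>
  The last conjunct is stability in the sense of the geometry of polynomials. It also excludes the
  zero polynomial, which is homogeneous of every degree.
\<close>

definition stable_form :: "'v set \<Rightarrow> nat \<Rightarrow> ('v, real) mpoly \<Rightarrow> bool" where
  "stable_form S d q \<longleftrightarrow>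
     indets q \<subseteq> S \<and> (\<forall>m. 0 \<le> Poly_Mapping.lookup q m) \<and>
     (\<forall>m\<in>Poly_Mapping.keys q. (\<Sum>i\<in>S. Poly_Mapping.lookup m i) = d) \<and>
     (\<forall>z::'v \<Rightarrow> complex. (\<forall>i\<in>S. 0 < Im (z i)) \<longrightarrow> eval_with of_real z q \<noteq> 0)"

lemma stable_form_mpeval_pos:
  assumes "stable_form S d q" "x \<in> orthant S"
  shows "0 < mpeval x q"
proof -
  have "eval_with of_real (\<lambda>_. \<i>) q \<noteq> 0"
    using assms(1) by (simp add: stable_form_def)
  then have "q \<noteq> 0"
    by auto
  then show ?thesis
    using assms by (intro mpeval_pos) (auto simp: stable_form_def)
qed

lemma monom_eval_mult: "monom_eval (\<lambda>i. x i * y i) m = monom_eval x m * monom_eval y m"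
  by (simp add: monom_eval_def power_mult_distrib prod.distrib)

lemma eval_with_homogeneous:
  assumes "finite S" "indets q \<subseteq> S"
    and "\<And>m. m \<in> Poly_Mapping.keys q \<Longrightarrow> (\<Sum>i\<in>S. Poly_Mapping.lookup m i) = d"
  shows "eval_with h (\<lambda>i. t * z i) q = t ^ d * eval_with h z q"
proof -
  have "monom_eval (\<lambda>i. t * z i) m = t ^ d * monom_eval z m" if "m \<in> Poly_Mapping.keys q" for m
  proof -
    have "Poly_Mapping.keys m \<subseteq> S"
      using that assms(2) keys_subset_indets by blast
    then have "monom_eval (\<lambda>_. t) m = t ^ d"
      using assms(1) by (simp add: monom_eval_superset flip: assms(3)[OF that] power_sum)
    then show ?thesis
      by (simp add: monom_eval_mult)
  qed
  then show ?thesis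
    by (simp add: eval_with_def sum_distrib_left algebra_simps)
qed

text \<open>
  The restriction of \<open>q\<close> to the line \<open>s \<mapsto> z + s a\<close>, as a polynomial in \<open>s\<close>.
\<close>

definition line_poly :: "('v \<Rightarrow> complex) \<Rightarrow> ('v \<Rightarrow> real) \<Rightarrow> ('v, real) mpoly \<Rightarrow> complex poly" where
  "line_poly z a q = eval_with (\<lambda>c. [:of_real c:]) (\<lambda>i. [:z i, of_real (a i):]) q"

lemma poly_line_poly:
  "poly (line_poly z a q) s = eval_with of_real (\<lambda>i. z i + s * of_real (a i)) q"
  by (simp add: line_poly_def eval_with_def monom_eval_def poly_sum poly_prod)

text \<open>
  As the direction has no zero entry, every monomial of \<open>q\<close> restricts to a polynomial of degree
  exactly \<open>d\<close>, and the leading coefficients add up to the value of \<open>q\<close> in the direction \<open>a\<close>.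
\<close>

lemma coeff_line_poly:
  assumes S: "finite S" and q: "stable_form S d q" and a: "a \<in> orthant S"
  shows "degree (line_poly z a q) = d" "coeff (line_poly z a q) d = of_real (mpeval a q)"
proof -
  let ?X = "\<lambda>i. [:z i, complex_of_real (a i):]"
  have m: "degree (monom_eval ?X m) = d \<and> coeff (monom_eval ?X m) d = of_real (monom_eval a m)"
    if m: "m \<in> Poly_Mapping.keys q" for m
  proof -
    have keys: "Poly_Mapping.keys m \<subseteq> S"
      using m q keys_subset_indets unfolding stable_form_def by blast
    have ne: "a i \<noteq> 0" if "i \<in> S" for i
      using a that by (auto simp: orthant_def)
    have "degree (monom_eval ?X m) = (\<Sum>i\<in>S. Poly_Mapping.lookup m i)"
      unfolding monom_eval_superset[OF S keys] using ne
      by (subst degree_prod_eq_sum_degree) (auto simp: degree_power_eq)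
    then have d: "degree (monom_eval ?X m) = d"
      using q m by (simp add: stable_form_def)
    have "lead_coeff (monom_eval ?X m) = of_real (monom_eval a m)"
      unfolding monom_eval_superset[OF S keys] using ne
      by (simp add: lead_coeff_prod lead_coeff_power)
    then show ?thesis
      using d by simp
  qed
  have "degree (line_poly z a q) \<le> d"
    unfolding line_poly_def eval_with_def using m
    by (intro degree_sum_le) (auto intro: order.trans[OF degree_smult_le])
  moreover show c: "coeff (line_poly z a q) d = of_real (mpeval a q)"
    using m by (simp add: line_poly_def eval_with_def mpeval_eq_eval_with coeff_sum)
  moreover have "mpeval a q > 0"
    by (rule stable_form_mpeval_pos[OF q a])
  ultimately show "degree (line_poly z a q) = d"
    by (intro antisym le_degree) auto
qed

lemma sum_ln_concave:
  fixes r :: "'i \<Rightarrow> real"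
  assumes "\<And>i. i \<in> I \<Longrightarrow> 0 < r i" "0 \<le> t" "t \<le> 1"
  shows "(1 - t) * (\<Sum>i\<in>I. ln (r i)) \<le> (\<Sum>i\<in>I. ln (t + (1 - t) * r i))"
proof -
  have "(1 - t) * ln (r i) \<le> ln (t + (1 - t) * r i)" if "i \<in> I" for i
    using concave_onD[OF ln_concave assms(2,3), of "r i" 1] assms(1)[OF that]
    by (simp add: algebra_simps)
  then show ?thesis
    by (simp add: sum_distrib_left sum_mono)
qed

text \<open>
  On the line \<open>s \<mapsto> x + s y\<close> with \<open>x\<close> and \<open>y\<close> in the orthant, \<open>q\<close> has only negative real roots
  \<open>- r j\<close>: stability excludes roots in the upper half-plane, homogeneity then excludes those in the
  lower one, and \<open>q\<close> is positive on the orthant. Homogeneity turns the factorization into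
  \<open>q ((1 - t) x + t y) = q y * (\<Prod>j. t + (1 - t) r j)\<close>, and the logarithm of each factor is concave.
\<close>

lemma stable_form_log_concave:
  assumes S: "finite S" and q: "stable_form S d q"
  shows "log_concave_on_orthant S q"
  unfolding log_concave_on_orthant_def
proof (intro conjI ballI allI impI)
  show "0 < mpeval x q" if "x \<in> orthant S" for x
    using stable_form_mpeval_pos[OF q that] .
next
  fix x y t assume x: "x \<in> orthant S" and y: "y \<in> orthant S" and t: "0 \<le> t \<and> t \<le> (1::real)"
  let ?P = "line_poly (\<lambda>i. of_real (x i)) y q"
  let ?c = "mpeval y q"
  have c: "?c > 0"
    by (rule stable_form_mpeval_pos[OF q y])
  have hom: "eval_with h (\<lambda>i. u * z i) q = u ^ d * eval_with h z q"
    for h and u :: "'b::comm_semiring_1" and z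
    using q by (intro eval_with_homogeneous[OF S]) (auto simp: stable_form_def)
  obtain root where "smult (lead_coeff ?P) (\<Prod>i<degree ?P. [:-root i, 1:]) = ?P"
    using complex_poly_decompose' .
  then have P: "?P = smult (of_real ?c) (\<Prod>j<d. [:-root j, 1:])"
    by (simp add: coeff_line_poly[OF S q y])
  define r where "r j = - Re (root j)" for j
  have roots: "root j = - of_real (r j) \<and> r j > 0" if "j < d" for j
  proof -
    define s where "s = root j"
    have "poly ?P s = 0"
      using that by (auto simp: P poly_prod s_def)
    then have 0: "eval_with of_real (\<lambda>i. of_real (x i) + s * of_real (y i)) q = 0"
      by (simp add: poly_line_poly)
    have xy: "0 < x i" "0 < y i" if "i \<in> S" for i
      using x y that by (auto simp: orthant_def)
    have "\<not> Im s > 0"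
      using 0 q xy by (auto simp: stable_form_def)
    moreover have "\<not> Im s < 0"
    proof
      assume "Im s < 0"
      then have "eval_with of_real (\<lambda>i. (-1) * (of_real (x i) + s * of_real (y i))) q \<noteq> 0"
        using q xy by (auto simp: stable_form_def mult_neg_pos)
      then show False
        unfolding hom using 0 by simp
    qed
    ultimately have s: "s = of_real (Re s)"
      by (simp add: complex_eq_iff)
    have "\<not> Re s \<ge> 0"
    proof
      assume "Re s \<ge> 0"
      then have "(\<lambda>i. x i + Re s * y i) \<in> orthant S"
        using xy by (auto simp: orthant_def add_pos_nonneg less_imp_le)
      then have "mpeval (\<lambda>i. x i + Re s * y i) q > 0"
        by (rule stable_form_mpeval_pos[OF q])
      moreover have "of_real (mpeval (\<lambda>i. x i + Re s * y i) q) = (0::complex)"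
        using 0 by (subst (asm) s) (simp flip: eval_with_of_real_real)
      ultimately show False
        by simp
    qed
    then show ?thesis
      using s by (simp add: r_def s_def)
  qed
  \<comment> \<open>The point for \<open>u\<close> is a multiple of \<open>x + s y\<close> with \<open>s = u / (1 - u)\<close>, which excludes \<open>u = 1\<close>.\<close>
  have prod: "mpeval (\<lambda>i. (1 - u) * x i + u * y i) q = ?c * (\<Prod>j<d. u + (1 - u) * r j)"
    if u: "0 \<le> u" "u < 1" for u
  proof -
    define s where "s = u / (1 - u)"
    have s: "(1 - u) * s = u"
      using u by (simp add: s_def)
    have "complex_of_real (mpeval (\<lambda>i. x i + s * y i) q) = poly ?P (of_real s)"
      by (simp add: poly_line_poly flip: eval_with_of_real_real)
    also have "\<dots> = of_real (?c * (\<Prod>j<d. s + r j))"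
      by (simp add: P poly_prod roots add.commute)
    finally have e: "mpeval (\<lambda>i. x i + s * y i) q = ?c * (\<Prod>j<d. s + r j)"
      by (simp only: of_real_eq_iff)
    have "mpeval (\<lambda>i. (1 - u) * x i + u * y i) q = mpeval (\<lambda>i. (1 - u) * (x i + s * y i)) q"
      by (simp only: distrib_left mult.assoc[symmetric] s)
    also have "\<dots> = (1 - u) ^ d * mpeval (\<lambda>i. x i + s * y i) q"
      by (simp add: mpeval_eq_eval_with hom)
    also have "\<dots> = ?c * (\<Prod>j<d. (1 - u) * (s + r j))"
      by (simp add: e prod.distrib)
    also have "\<dots> = ?c * (\<Prod>j<d. u + (1 - u) * r j)"
      by (simp add: distrib_left s)
    finally show ?thesis .
  qed
  show "(1 - t) * ln (mpeval x q) + t * ln ?c \<le> ln (mpeval (\<lambda>i. (1 - t) * x i + t * y i) q)"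
  proof (cases "t = 1")
    case False
    then have t': "0 \<le> t" "t < 1"
      using t by auto
    have ln: "ln (mpeval (\<lambda>i. (1 - u) * x i + u * y i) q) = ln ?c + (\<Sum>j<d. ln (u + (1 - u) * r j))"
      if u: "0 \<le> u" "u < 1" for u
    proof -
      have "0 < u + (1 - u) * r j" if "j < d" for j
        using u roots[OF that] by (simp add: add_nonneg_pos)
      then have "0 < u + (1 - u) * r j \<and> u + (1 - u) * r j \<noteq> 0" if "j < d" for j
        using that by (simp add: less_imp_neq[symmetric])
      then show ?thesis
        unfolding prod[OF u] using c by (subst ln_mult_pos) (auto intro!: ln_prod prod_pos)
    qed
    have "(1 - t) * (ln ?c + (\<Sum>j<d. ln (r j))) + t * ln ?c =
        ln ?c + (1 - t) * (\<Sum>j<d. ln (r j))"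
      by (simp add: algebra_simps)
    also have "\<dots> \<le> ln ?c + (\<Sum>j<d. ln (t + (1 - t) * r j))"
      using roots t by (intro add_left_mono sum_ln_concave) auto
    finally show ?thesis
      using ln[OF t'] ln[of 0] by simp
  qed simp
qed

lemma lookup_mpderiv_dir:
  "Poly_Mapping.lookup (mpderiv_dir S a p) m =
    (\<Sum>j\<in>S. a j * (of_nat (Suc (Poly_Mapping.lookup m j)) *
       Poly_Mapping.lookup p (m + Poly_Mapping.single j 1)))"
  unfolding mpderiv_dir_def lookup_sum
  by (intro sum.cong refl) (auto simp: map.rep_eq when_def lookup_mpderiv simp del: of_nat_Suc)

lemma keys_mpderiv_dir:
  assumes "m \<in> Poly_Mapping.keys (mpderiv_dir S a p)"
  shows "\<exists>j\<in>S. m + Poly_Mapping.single j 1 \<in> Poly_Mapping.keys p"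
proof (rule ccontr)
  assume "\<not> ?thesis"
  then have "Poly_Mapping.lookup (mpderiv_dir S a p) m = 0"
    by (simp add: lookup_mpderiv_dir in_keys_iff)
  then show False
    using assms by (simp add: in_keys_iff)
qed

lemma indets_mpderiv_dir:
  assumes "indets q \<subseteq> S"
  shows "indets (mpderiv_dir S a q) \<subseteq> S"
proof
  fix i assume "i \<in> indets (mpderiv_dir S a q)"
  then obtain m where m: "m \<in> Poly_Mapping.keys (mpderiv_dir S a q)" "i \<in> Poly_Mapping.keys m"
    by (auto simp: indets_def)
  then obtain j where "m + Poly_Mapping.single j 1 \<in> Poly_Mapping.keys q"
    using keys_mpderiv_dir by blast
  then have "Poly_Mapping.keys (m + Poly_Mapping.single j 1) \<subseteq> S"
    using assms keys_subset_indets by blast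
  then show "i \<in> S"
    using m(2) by (auto simp: in_keys_iff lookup_add)
qed

lemma mpderiv_dir_add: "mpderiv_dir S a (p + q) = mpderiv_dir S a p + mpderiv_dir S a q"
  by (intro poly_mapping_eqI)
    (simp add: lookup_mpderiv_dir lookup_add distrib_left sum.distrib del: of_nat_Suc)

lemma lookup_scale:
  fixes p :: "('v, 'b::comm_semiring_1) mpoly"
  shows "Poly_Mapping.lookup (Poly_Mapping.map ((*) c) p) m = c * Poly_Mapping.lookup p m"
  by (simp add: map.rep_eq when_def)

lemma mpderiv_dir_scale:
  "mpderiv_dir S a (Poly_Mapping.map ((*) c) p) = Poly_Mapping.map ((*) c) (mpderiv_dir S a p)"
  by (intro poly_mapping_eqI)
    (simp add: lookup_mpderiv_dir lookup_scale sum_distrib_left mult_ac del: of_nat_Suc)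

lemma mpderiv_mat_0 [simp]: "mpderiv_mat S 0 A p = p"
  by (simp add: mpderiv_mat_def)

text \<open>
  The definition folds over \<open>[0..<r]\<close>, so the last row of the matrix acts first.
\<close>

lemma mpderiv_mat_Suc: "mpderiv_mat S (Suc r) A p = mpderiv_mat S r A (mpderiv_dir S (A r) p)"
  by (simp add: mpderiv_mat_def)

lemma mpderiv_mat_Suc':
  "mpderiv_mat S (Suc r) A p = mpderiv_dir S (A 0) (mpderiv_mat S r (\<lambda>i. A (Suc i)) p)"
  by (induction r arbitrary: p) (simp_all add: mpderiv_mat_Suc)

lemma mpderiv_mat_add: "mpderiv_mat S r A (p + q) = mpderiv_mat S r A p + mpderiv_mat S r A q"
  by (induction r arbitrary: p q) (simp_all add: mpderiv_mat_Suc mpderiv_dir_add)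

lemma mpderiv_mat_scale:
  "mpderiv_mat S r A (Poly_Mapping.map ((*) c) p) = Poly_Mapping.map ((*) c) (mpderiv_mat S r A p)"
  by (induction r arbitrary: p) (simp_all add: mpderiv_mat_Suc mpderiv_dir_scale)

lemma mpderiv_dir_0 [simp]: "mpderiv_dir S a 0 = 0"
  by (intro poly_mapping_eqI) (simp add: lookup_mpderiv_dir)

lemma mpderiv_mat_zero [simp]: "mpderiv_mat S r A 0 = 0"
  by (induction r) (simp_all add: mpderiv_mat_Suc)

lemma mpderiv_mat_sum: "mpderiv_mat S r A (\<Sum>j\<in>J. p j) = (\<Sum>j\<in>J. mpderiv_mat S r A (p j))"
  by (induction J rule: infinite_finite_induct) (simp_all add: mpderiv_mat_add)

text \<open>
  The first derivative taken is a linear combination of partial derivatives with the entries of a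
  row as coefficients, so by linearity the value for \<open>Suc r\<close> rows is the same linear combination of
  values for \<open>r\<close> rows.
\<close>

lemma mpeval_mpderiv_mat_tendsto:
  fixes p :: "('v, real) mpoly"
  assumes "\<And>i j. (\<lambda>n. B n i j) \<longlonglongrightarrow> A i j"
  shows "(\<lambda>n. mpeval x (mpderiv_mat S r (B n) p)) \<longlonglongrightarrow> mpeval x (mpderiv_mat S r A p)"
proof (induction r arbitrary: p)
  case (Suc r)
  have "mpeval x (mpderiv_mat S (Suc r) C p) =
      (\<Sum>j\<in>S. C r j * mpeval x (mpderiv_mat S r C (mpderiv j p)))" for C
    unfolding mpderiv_mat_Suc mpderiv_dir_def mpderiv_mat_sum mpderiv_mat_scale mpeval_eq_eval_with
    by (simp add: eval_with_sum eval_with_scale)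
  then show ?case
    using assms Suc by (auto intro!: tendsto_sum tendsto_mult)
qed simp

text \<open>
  The chain rule along the line \<open>s \<mapsto> z + s a\<close>, at \<open>s = 0\<close>.
\<close>

lemma pderiv_line_poly:
  assumes S: "finite S" and q: "indets q \<subseteq> S"
  shows "poly (pderiv (line_poly z a q)) 0 = eval_with of_real z (mpderiv_dir S a q)"
proof -
  let ?l = Poly_Mapping.lookup and ?k = Poly_Mapping.keys
  let ?X = "\<lambda>i. [:z i, complex_of_real (a i):]"
  let ?e = "\<lambda>j. Poly_Mapping.single j (1::nat)"
  have m: "poly (pderiv (monom_eval ?X m)) 0 =
      (\<Sum>j\<in>S. of_real (a j) * (of_nat (?l m j) * monom_eval z (m - ?e j)))"
    if m: "m \<in> ?k q" for m
  proof -
    have keys: "?k m \<subseteq> S"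
      using m q keys_subset_indets by blast
    have "poly (pderiv (monom_eval ?X m)) 0 =
        (\<Sum>j\<in>S. (\<Prod>i\<in>S - {j}. z i ^ ?l m i) * (of_nat (?l m j) * (z j ^ (?l m j - 1) * of_real (a j))))"
      unfolding monom_eval_superset[OF S keys]
      by (simp add: pderiv_prod pderiv_power pderiv_pCons poly_sum poly_prod mult_ac)
    also have "\<dots> = (\<Sum>j\<in>S. of_real (a j) * (of_nat (?l m j) * monom_eval z (m - ?e j)))"
    proof (rule sum.cong[OF refl])
      fix j assume j: "j \<in> S"
      have "?k (m - ?e j) \<subseteq> S"
        using keys by (auto simp: in_keys_iff lookup_minus)
      then have "monom_eval z (m - ?e j) = z j ^ (?l m j - 1) * (\<Prod>i\<in>S - {j}. z i ^ ?l m i)"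
        using S j by (auto simp: monom_eval_superset prod.remove lookup_minus lookup_single
            intro!: prod.cong)
      then show "(\<Prod>i\<in>S - {j}. z i ^ ?l m i) * (of_nat (?l m j) * (z j ^ (?l m j - 1) * of_real (a j))) =
          of_real (a j) * (of_nat (?l m j) * monom_eval z (m - ?e j))"
        by simp
    qed
    finally show ?thesis .
  qed
  have "eval_with of_real z (mpderiv_dir S a q) =
      (\<Sum>j\<in>S. of_real (a j) * (\<Sum>m\<in>?k q. of_nat (?l m j) * of_real (?l q m) * monom_eval z (m - ?e j)))"
    by (simp add: mpderiv_dir_def mpderiv_def eval_with_sum eval_with_scale)
  also have "\<dots> = (\<Sum>m\<in>?k q. of_real (?l q m) * poly (pderiv (monom_eval ?X m)) 0)"
    unfolding sum_distrib_left by (subst sum.swap) (simp add: m sum_distrib_left mult_ac)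
  also have "\<dots> = poly (pderiv (line_poly z a q)) 0"
    by (simp add: line_poly_def eval_with_def higher_pderiv_sum[where n = 1, simplified] pderiv_smult poly_sum)
  finally show ?thesis ..
qed

text \<open>
  The Gauss-Lucas argument: \<open>p' 0 / p 0\<close> is the sum of the numbers \<open>- 1 / a\<close> over the roots \<open>a\<close>.
  Each of them has negative imaginary part, so the sum cannot vanish.
\<close>

lemma pderiv_nonzero_if_roots_below:
  fixes p :: "complex poly"
  assumes "degree p > 0" and "\<And>s. 0 \<le> Im s \<Longrightarrow> poly p s \<noteq> 0"
  shows "poly (pderiv p) 0 \<noteq> 0"
proof -
  obtain root where p: "smult (lead_coeff p) (\<Prod>i<degree p. [:-root i, 1:]) = p"
    using complex_poly_decompose' .
  have "poly p (root i) = 0" if "i < degree p" for i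
    by (subst p[symmetric]) (use that in \<open>auto simp: poly_prod\<close>)
  then have root: "Im (root i) < 0" if "i < degree p" for i
    using assms(2)[of "root i"] that by force
  let ?R = "\<lambda>n. \<Prod>i<n. [:-root i, 1:]"
  \<comment> \<open>The weak inequality covers the empty product and carries the induction.\<close>
  have "poly (?R n) 0 \<noteq> 0 \<and> Im (poly (pderiv (?R n)) 0 / poly (?R n) 0) \<le> 0 \<and>
      (n > 0 \<longrightarrow> Im (poly (pderiv (?R n)) 0 / poly (?R n) 0) < 0)" if "n \<le> degree p" for n
    using that
  proof (induction n)
    case (Suc n)
    then have IH: "poly (?R n) 0 \<noteq> 0" "Im (poly (pderiv (?R n)) 0 / poly (?R n) 0) \<le> 0"
      and r: "Im (root n) < 0"
      using root by auto
    then have r0: "root n \<noteq> 0"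
      by auto
    have R: "?R (Suc n) = [:-root n, 1:] * ?R n"
      by (simp add: mult.commute)
    have "poly (pderiv (?R (Suc n))) 0 / poly (?R (Suc n)) 0 =
        poly (pderiv (?R n)) 0 / poly (?R n) 0 - 1 / root n"
    proof -
      have "pderiv ([:-root n, 1:] * ?R n) = [:-root n, 1:] * pderiv (?R n) + ?R n"
        by (simp only: pderiv_mult) (simp add: pderiv_pCons)
      then have "poly (pderiv ([:-root n, 1:] * ?R n)) 0 =
          - root n * poly (pderiv (?R n)) 0 + poly (?R n) 0"
        by (simp only: poly_add poly_mult) simp
      moreover have "poly ([:-root n, 1:] * ?R n) 0 = - root n * poly (?R n) 0"
        by (simp only: poly_mult) simp
      ultimately show ?thesis
        unfolding R using IH(1) r0 by (simp only:) (simp add: field_simps)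
    qed
    moreover have "Im (1 / root n) > 0"
      using r r0 by (simp add: Im_divide complex_neq_0 divide_neg_pos)
    moreover have "poly (?R (Suc n)) 0 \<noteq> 0"
      unfolding R using IH(1) r0 by simp
    ultimately show ?case
      using IH(2) by simp
  qed simp
  from this[of "degree p"] have "poly (pderiv (?R (degree p))) 0 \<noteq> 0"
    using assms(1) by auto
  moreover have "lead_coeff p \<noteq> 0"
    using assms(1) by auto
  ultimately show ?thesis
    by (subst p[symmetric]) (simp add: pderiv_smult)
qed

text \<open>
  For \<open>z\<close> in the product of upper half-planes, the polynomial \<open>s \<mapsto> q (z + s a)\<close> has all its roots in
  the open lower half-plane, and its derivative at 0 is the directional derivative of \<open>q\<close> at \<open>z\<close>.
  That \<open>a\<close> is strictly positive ensures that this polynomial is not constant.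
\<close>

lemma stable_form_mpderiv_dir:
  assumes S: "finite S" and q: "stable_form S (Suc d) q" and a: "a \<in> orthant S"
  shows "stable_form S d (mpderiv_dir S a q)"
  unfolding stable_form_def
proof (intro conjI allI ballI impI)
  let ?l = Poly_Mapping.lookup and ?k = Poly_Mapping.keys
  show "indets (mpderiv_dir S a q) \<subseteq> S"
    using q by (intro indets_mpderiv_dir) (simp add: stable_form_def)
  show "0 \<le> ?l (mpderiv_dir S a q) m" for m
    using q a by (auto simp: lookup_mpderiv_dir stable_form_def orthant_def less_imp_le
        intro!: sum_nonneg mult_nonneg_nonneg)
  show "(\<Sum>i\<in>S. ?l m i) = d" if m: "m \<in> ?k (mpderiv_dir S a q)" for m
  proof -
    obtain j where j: "j \<in> S" "m + Poly_Mapping.single j 1 \<in> ?k q"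
      using keys_mpderiv_dir[OF m] by blast
    then have "(\<Sum>i\<in>S. ?l (m + Poly_Mapping.single j 1) i) = Suc d"
      using q by (simp add: stable_form_def)
    then show ?thesis
      using S j(1) by (simp add: lookup_add lookup_single sum.distrib when_def)
  qed
  fix z :: "'a \<Rightarrow> complex" assume z: "\<forall>i\<in>S. 0 < Im (z i)"
  have "poly (line_poly z a q) s \<noteq> 0" if "Im s \<ge> 0" for s
  proof -
    have "\<forall>i\<in>S. 0 < Im (z i + s * of_real (a i))"
      using z a that by (auto simp: orthant_def less_imp_le intro!: add_pos_nonneg mult_nonneg_nonneg)
    then show ?thesis
      using q by (simp add: poly_line_poly stable_form_def)
  qed
  then have "poly (pderiv (line_poly z a q)) 0 \<noteq> 0"
    by (intro pderiv_nonzero_if_roots_below) (simp_all add: coeff_line_poly[OF S q a])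
  then show "eval_with of_real z (mpderiv_dir S a q) \<noteq> 0"
    using pderiv_line_poly[OF S, of q z a] q by (simp add: stable_form_def)
qed

lemma mpderiv_dir_constant:
  assumes S: "finite S" and q: "stable_form S 0 q"
  shows "mpderiv_dir S a q = 0"
proof (rule poly_mapping_eqI)
  fix m
  have "Poly_Mapping.lookup q (m + Poly_Mapping.single j 1) = 0" if "j \<in> S" for j
  proof (rule ccontr)
    assume "Poly_Mapping.lookup q (m + Poly_Mapping.single j 1) \<noteq> 0"
    then have "(\<Sum>i\<in>S. Poly_Mapping.lookup (m + Poly_Mapping.single j 1) i) = 0"
      using q by (simp add: stable_form_def in_keys_iff)
    then show False
      using S that by (auto simp: lookup_add)
  qed
  then show "Poly_Mapping.lookup (mpderiv_dir S a q) m = Poly_Mapping.lookup 0 m"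
    by (simp add: lookup_mpderiv_dir)
qed

lemma stable_form_mpderiv_mat:
  assumes S: "finite S" and q: "stable_form S d q" and A: "\<And>i. i < r \<Longrightarrow> A i \<in> orthant S"
  shows "mpderiv_mat S r A q = 0 \<or> (\<exists>e. stable_form S e (mpderiv_mat S r A q))"
  using q A
proof (induction r arbitrary: d q)
  case (Suc r)
  show ?case
  proof (cases d)
    case 0
    then show ?thesis
      using mpderiv_dir_constant[OF S] Suc.prems by (simp add: mpderiv_mat_Suc)
  next
    case d: (Suc e)
    have "stable_form S e (mpderiv_dir S (A r) q)"
      using Suc.prems d by (intro stable_form_mpderiv_dir[OF S]) simp_all
    from Suc.IH[OF this] Suc.prems(2) show ?thesis
      by (simp add: mpderiv_mat_Suc less_SucI)
  qed
next
  case 0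
  then show ?case
    by (intro disjI2 exI[of _ d]) simp
qed

lemma mpderiv_mat_nonneg:
  fixes q :: "('v, real) mpoly"
  assumes "\<And>m. 0 \<le> Poly_Mapping.lookup q m" "\<And>i j. i < r \<Longrightarrow> j \<in> S \<Longrightarrow> 0 \<le> A i j"
  shows "0 \<le> Poly_Mapping.lookup (mpderiv_mat S r A q) m"
  using assms
proof (induction r arbitrary: q)
  case (Suc r)
  show ?case
    unfolding mpderiv_mat_Suc using Suc.prems
    by (intro Suc.IH) (auto simp: lookup_mpderiv_dir intro!: sum_nonneg mult_nonneg_nonneg)
qed auto

lemma indets_mpderiv_mat:
  "indets q \<subseteq> S \<Longrightarrow> indets (mpderiv_mat S r A q) \<subseteq> S"
  by (induction r arbitrary: q) (simp_all add: mpderiv_mat_Suc indets_mpderiv_dir)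

text \<open>
  The matrix is approximated by matrices with positive entries. Their derivatives converge pointwise
  to a polynomial that is positive on the orthant, so they are eventually nonzero, hence stable forms,
  and the inequality of log-concavity holds in the limit.
\<close>

lemma mpderiv_mat_log_concave:
  assumes S: "finite S" and q: "stable_form S d q"
    and A: "\<And>i j. i < r \<Longrightarrow> j \<in> S \<Longrightarrow> 0 \<le> A i j"
  shows "mpderiv_mat S r A q = 0 \<or> log_concave_on_orthant S (mpderiv_mat S r A q)"
proof (cases "mpderiv_mat S r A q = 0")
  case False
  let ?q = "mpderiv_mat S r A q"
  define B where "B n i j = A i j + inverse (real (Suc n))" for n i j
  let ?q' = "\<lambda>n. mpderiv_mat S r (B n) q"
  have pos: "0 < mpeval x ?q" if "x \<in> orthant S" for x
    using q A that False
    by (intro mpeval_pos[of _ S] mpderiv_mat_nonneg indets_mpderiv_mat) (auto simp: stable_form_def)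
  have lim: "(\<lambda>n. mpeval x (?q' n)) \<longlonglongrightarrow> mpeval x ?q" for x
  proof (rule mpeval_mpderiv_mat_tendsto)
    fix i j
    show "(\<lambda>n. B n i j) \<longlonglongrightarrow> A i j"
      unfolding B_def using tendsto_add[OF tendsto_const LIMSEQ_inverse_real_of_nat] by force
  qed
  have ev: "\<forall>\<^sub>F n in sequentially. log_concave_on_orthant S (?q' n)"
  proof -
    have "\<forall>\<^sub>F n in sequentially. 0 < mpeval (\<lambda>_. 1) (?q' n)"
      using lim[of "\<lambda>_. 1"] pos[of "\<lambda>_. 1"] by (intro order_tendstoD(1)) (auto simp: orthant_def)
    then show ?thesis
    proof eventually_elim
      case (elim n)
      then have "?q' n \<noteq> 0"
        by (auto simp: mpeval_eq_eval_with)
      moreover have "B n i \<in> orthant S" if "i < r" for i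
        using A[OF that] by (auto simp: orthant_def B_def add_nonneg_pos)
      ultimately obtain e where "stable_form S e (?q' n)"
        using stable_form_mpderiv_mat[OF S q] by blast
      then show ?case
        by (rule stable_form_log_concave[OF S])
    qed
  qed
  have "log_concave_on_orthant S ?q"
    unfolding log_concave_on_orthant_def
  proof (intro conjI ballI allI impI)
    fix x y t assume x: "x \<in> orthant S" and y: "y \<in> orthant S" and t: "0 \<le> t \<and> t \<le> (1::real)"
    let ?w = "\<lambda>i. (1 - t) * x i + t * y i"
    have w: "?w \<in> orthant S"
      unfolding orthant_def
    proof safe
      fix i assume "i \<in> S"
      then have "0 < x i" "0 < y i"
        using x y by (auto simp: orthant_def)
      then show "0 < ?w i"
        using t by (cases "t = 0") (auto simp: add_nonneg_pos)
    qed
    have ln: "(\<lambda>n. ln (mpeval v (?q' n))) \<longlonglongrightarrow> ln (mpeval v ?q)" if "v \<in> orthant S" for v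
      using pos[OF that] by (intro tendsto_ln lim) auto
    show "(1 - t) * ln (mpeval x ?q) + t * ln (mpeval y ?q) \<le> ln (mpeval ?w ?q)"
    proof (rule tendsto_le[OF sequentially_bot ln[OF w]])
      show "(\<lambda>n. (1 - t) * ln (mpeval x (?q' n)) + t * ln (mpeval y (?q' n)))
          \<longlonglongrightarrow> (1 - t) * ln (mpeval x ?q) + t * ln (mpeval y ?q)"
        by (intro tendsto_intros ln x y)
      show "\<forall>\<^sub>F n in sequentially. (1 - t) * ln (mpeval x (?q' n)) + t * ln (mpeval y (?q' n))
          \<le> ln (mpeval ?w (?q' n))"
        using ev by eventually_elim (use x y t in \<open>auto simp: log_concave_on_orthant_def\<close>)
    qed
  qed (use pos in auto)
  then show ?thesis ..
qed simp

text \<open>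
  A partial derivative is a directional derivative along a unit vector.
\<close>

lemma mpderiv_multi_is_mpderiv_mat:
  fixes q :: "('v, real) mpoly"
  assumes "finite S"
  obtains r A where "\<And>i j. i < r \<Longrightarrow> j \<in> S \<Longrightarrow> 0 \<le> A i j"
    "mpderiv_multi S \<alpha> q = mpderiv_mat S r A q"
proof -
  define R where "R p \<longleftrightarrow> (\<exists>r A. (\<forall>i<r. \<forall>j\<in>S. 0 \<le> A i j) \<and> p = mpderiv_mat S r A q)" for p
  have dir: "mpderiv i p = mpderiv_dir S (\<lambda>j. if j = i then 1 else 0) p" if "i \<in> S" for i and p :: "('v, real) mpoly"
    by (intro poly_mapping_eqI)
      (use that assms in \<open>simp add: lookup_mpderiv lookup_mpderiv_dir if_distrib[of "\<lambda>c. c * _"] del: of_nat_Suc cong: if_cong\<close>)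
  have one: "R (mpderiv i p)" if p: "R p" and i: "i \<in> S" for i p
  proof -
    obtain r A where A: "\<forall>i<r. \<forall>j\<in>S. 0 \<le> A i j" "p = mpderiv_mat S r A q"
      using p by (auto simp: R_def)
    \<comment> \<open>Row 0 of a matrix acts last, so the new direction is put in front.\<close>
    let ?A = "\<lambda>l. case l of 0 \<Rightarrow> (\<lambda>j. if j = i then 1 else 0) | Suc l \<Rightarrow> A l"
    have "mpderiv i p = mpderiv_mat S (Suc r) ?A q"
      using A(2) by (simp add: mpderiv_mat_Suc' dir[OF i])
    moreover have "\<forall>i<Suc r. \<forall>j\<in>S. 0 \<le> ?A i j"
      using A(1) by (auto split: nat.split)
    ultimately show ?thesis
      unfolding R_def by blast
  qed
  have pow: "R ((mpderiv i ^^ k) p)" if "R p" "i \<in> S" for i k p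
    by (induction k) (use that one in auto)
  have "R (mpderiv_multi T \<alpha> q)" if "finite T" "T \<subseteq> S" for T
    using that
  proof (induction T)
    case empty
    show ?case
      unfolding R_def by (intro exI[of _ 0]) simp
  qed (simp add: mpderiv_multi_insert pow)
  then have "R (mpderiv_multi S \<alpha> q)"
    using assms by simp
  then show thesis
    using that unfolding R_def by blast
qed

theorem stable_form_strongly_and_completely_log_concave:
  assumes S: "finite S" and q: "stable_form S d q"
  shows "strongly_log_concave S q" "completely_log_concave S q"
proof -
  show "completely_log_concave S q"
    using q mpderiv_mat_log_concave[OF S q]
    by (auto simp: completely_log_concave_def stable_form_def)
  have "mpderiv_multi S \<alpha> q = 0 \<or> log_concave_on_orthant S (mpderiv_multi S \<alpha> q)" for \<alpha>
    using mpderiv_multi_is_mpderiv_mat[OF S, of \<alpha> q] mpderiv_mat_log_concave[OF S q] by metis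
  then show "strongly_log_concave S q"
    using q by (auto simp: strongly_log_concave_def stable_form_def)
qed

section \<open>Distances in a graph and in its blowups\<close>

text \<open>
  Both sides are the same unspecified number if \<open>Q\<close> holds nowhere.
\<close>

lemma Least_eq_if_dominated:
  fixes P Q :: "nat \<Rightarrow> bool"
  assumes "\<And>l. P l \<Longrightarrow> Q l" "\<And>l. Q l \<Longrightarrow> \<exists>l'\<le>l. P l'"
  shows "(LEAST l. P l) = (LEAST l. Q l)"
proof (cases "\<exists>l. Q l")
  case True
  then have Q: "Q (LEAST l. Q l)"
    by (auto intro: LeastI)
  then obtain l where l: "l \<le> (LEAST l. Q l)" "P l"
    using assms(2) by blast
  then have "P (LEAST l. P l)" "(LEAST l. P l) \<le> (LEAST l. Q l)"
    by (auto intro: LeastI Least_le order.trans)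
  then show ?thesis
    using assms(1) by (intro antisym) (auto intro: Least_le)
next
  case False
  then have "P = Q"
    using assms(1) by blast
  then show ?thesis by simp
qed

lemma (in pair_wf_digraph) awalk_iff_relpow:
  "(\<exists>p. awalk v p w \<and> length p = l) \<longleftrightarrow> v \<in> pverts G \<and> (v, w) \<in> parcs G ^^ l"
proof (induction l arbitrary: v)
  case 0
  show ?case
    by (auto simp: awalk_Nil_iff)
next
  case (Suc l)
  have "(\<exists>p. awalk v p w \<and> length p = Suc l) \<longleftrightarrow>
      (\<exists>u. (v, u) \<in> parcs G \<and> (\<exists>p. awalk u p w \<and> length p = l))"
  proof (intro iffI; elim exE conjE)
    fix p assume "awalk v p w" "length p = Suc l"
    then show "\<exists>u. (v, u) \<in> parcs G \<and> (\<exists>p. awalk u p w \<and> length p = l)"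
      by (cases p) (auto simp: awalk_Cons_iff, blast)
  next
    fix u p assume "(v, u) \<in> parcs G" "awalk u p w" "length p = l"
    then show "\<exists>p. awalk v p w \<and> length p = Suc l"
      by (intro exI[of _ "(v, u) # p"]) (simp add: awalk_Cons_iff)
  qed
  also have "\<dots> \<longleftrightarrow> v \<in> pverts G \<and> (v, w) \<in> parcs G ^^ Suc l"
    unfolding Suc.IH using in_arcsD1 in_arcsD2 by (blast intro: relpow_Suc_I2 dest: relpow_Suc_D2)
  finally show ?case .
qed

lemma (in pair_wf_digraph) awalk_imp_shorter_apath:
  assumes "awalk v p w"
  shows "\<exists>p'. apath v p' w \<and> length p' \<le> length p"
  using assms
proof (induction rule: awalk_to_apath_induct)
  case (path p)
  then show ?case
    by (auto simp: apath_def)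
next
  case (decomp p q r s)
  have "is_awalk_cyc_decomp p (q, r, s)"
    using awalk_cyc_decomp_has_prop[OF decomp(1)] decomp(2,3) by simp
  then have "length (q @ s) \<le> length p"
    by auto
  then show ?case
    using decomp(4) by (meson order.trans)
qed

text \<open>
  Powers of the adjacency relation count the lengths of all walks; a shortest walk may be taken to be
  a path.
\<close>

lemma graph_dist_eq_Least_relpow:
  assumes "pair_wf_digraph H" "v \<in> pverts H"
  shows "graph_dist H v w = (LEAST l. (v, w) \<in> parcs H ^^ l)"
proof -
  interpret pair_wf_digraph H by fact
  show ?thesis
    unfolding graph_dist_def
  proof (rule Least_eq_if_dominated)
    fix l assume "\<exists>p. apath v p w \<and> length p = l"
    then show "(v, w) \<in> parcs H ^^ l"
      using awalk_iff_relpow[of v w l] by (auto simp: apath_def)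
  next
    fix l assume "(v, w) \<in> parcs H ^^ l"
    then obtain p where "awalk v p w" "length p = l"
      using awalk_iff_relpow[of v w l] assms(2) by blast
    then show "\<exists>l'\<le>l. \<exists>p. apath v p w \<and> length p = l'"
      using awalk_imp_shorter_apath by blast
  qed
qed

locale connected_simple_graph =
  fixes G :: "'a pair_pre_digraph"
  assumes graph: "pair_graph G"
    and connected: "Digraph_Component.connected (with_proj G)"
    and two_vertices: "card (pverts G) \<ge> 2"
begin

abbreviation "V \<equiv> pverts G"
abbreviation "E \<equiv> parcs G"
abbreviation "d \<equiv> graph_dist G"

lemma wf: "pair_wf_digraph G"
  using graph by (simp add: pair_graph_def pair_digraph_def pair_fin_digraph_def)

lemma finite_V [simp]: "finite V"
  using graph by (simp add: pair_graph_def pair_digraph_def pair_fin_digraph_def pair_fin_digraph_axioms_def)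

lemma arc_in_V: "(u, v) \<in> E \<Longrightarrow> u \<in> V \<and> v \<in> V"
  using pair_wf_digraph.wellformed'[OF wf] by blast

lemma arc_sym: "(u, v) \<in> E \<Longrightarrow> (v, u) \<in> E"
proof -
  interpret pair_graph G by (rule graph)
  show "(u, v) \<in> E \<Longrightarrow> (v, u) \<in> E"
    by (rule arcs_symmetric)
qed

lemma arc_irrefl: "(u, u) \<notin> E"
proof -
  interpret pair_graph G by (rule graph)
  show ?thesis
    using pair_no_loops by fastforce
qed

lemma relpow_sym: "(u, v) \<in> E ^^ l \<Longrightarrow> (v, u) \<in> E ^^ l"
proof (induction l arbitrary: v)
  case (Suc l)
  then obtain w where "(u, w) \<in> E ^^ l" "(w, v) \<in> E"
    by auto
  then show ?case
    using Suc.IH arc_sym by (blast intro: relpow_Suc_I2)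
qed simp

lemma reachable: 
  assumes "u \<in> V" "v \<in> V" 
  shows "\<exists>l. (u, v) \<in> E ^^ l"
proof -
  interpret pair_graph G by (rule graph)
  have "strongly_connected (with_proj G)"
    using symmetric_connected_imp_strongly_connected[OF _ connected] sym_arcs by simp
  then have "u \<rightarrow>\<^sup>*\<^bsub>with_proj G\<^esub> v"
    using assms by (auto simp: strongly_connected_def)
  then obtain p where "awalk u p v"
    using reachable_awalk by blast
  then show ?thesis
    using awalk_iff_relpow[of u v "length p"] by blast
qed

lemma d_eq: "u \<in> V \<Longrightarrow> d u v = (LEAST l. (u, v) \<in> E ^^ l)"
  by (rule graph_dist_eq_Least_relpow[OF wf])

lemma relpow_d: "u \<in> V \<Longrightarrow> v \<in> V \<Longrightarrow> (u, v) \<in> E ^^ d u v"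
  using LeastI_ex[OF reachable[of u v]] by (simp add: d_eq)

lemma d_le: "u \<in> V \<Longrightarrow> (u, v) \<in> E ^^ l \<Longrightarrow> d u v \<le> l"
  by (auto simp: d_eq intro: Least_le)

lemma d_sym: "u \<in> V \<Longrightarrow> v \<in> V \<Longrightarrow> d u v = d v u"
  using d_le[OF _ relpow_sym[OF relpow_d]] by (simp add: antisym)

lemma d_refl [simp]: "u \<in> V \<Longrightarrow> d u u = 0"
  using d_le[of u u 0] by simp

lemma d_arc: "(u, v) \<in> E \<Longrightarrow> d u v = 1"
proof -
  assume uv: "(u, v) \<in> E"
  then have V: "u \<in> V" "v \<in> V"
    using arc_in_V by auto
  have "d u v \<noteq> 0"
    using relpow_d[OF V] uv arc_irrefl by (metis relpow_0_E)
  moreover have "d u v \<le> 1"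
    using d_le[of u v 1] V uv by simp
  ultimately show ?thesis by simp
qed

lemma d_ge_2:
  assumes "u \<in> V" "v \<in> V" "u \<noteq> v" "(u, v) \<notin> E"
  shows "2 \<le> d u v"
proof (rule ccontr)
  assume "\<not> 2 \<le> d u v"
  then have "d u v = 0 \<or> d u v = 1"
    by auto
  then show False
    using relpow_d[OF assms(1,2)] assms(3,4) by auto
qed

lemma ex_neighbour:
  assumes "u \<in> V"
  shows "\<exists>v. (u, v) \<in> E"
proof -
  have "V \<noteq> {u}"
    using two_vertices by auto
  then obtain v where v: "v \<in> V" "v \<noteq> u"
    using assms by blast
  then obtain l where "(u, v) \<in> E ^^ l"
    using reachable assms by blast
  moreover from this v(2) obtain l' where "l = Suc l'"
    by (cases l) auto
  ultimately show ?thesis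
    using relpow_Suc_D2 by metis
qed

text \<open>
  The distance matrix with diagonal entries 2, the common distance between copies of a vertex.
\<close>

definition N :: "'a \<Rightarrow> 'a \<Rightarrow> int" where
  "N u v = int (d u v) + (if u = v then 2 else 0)"

context
  fixes n :: "'a \<Rightarrow> nat"
  assumes n: "\<And>v. v \<in> V \<Longrightarrow> 0 < n v"
begin

lemma blowup_wf: "pair_wf_digraph (blowup G n)"
  by unfold_locales (auto simp: blowup_def dest: arc_in_V)

lemma relpow_blowup_fst: "(x, y) \<in> parcs (blowup G n) ^^ l \<Longrightarrow> (fst x, fst y) \<in> E ^^ l"
proof (induction l arbitrary: y)
  case (Suc l)
  then obtain w where "(x, w) \<in> parcs (blowup G n) ^^ l" "(w, y) \<in> parcs (blowup G n)"
    by auto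
  moreover from this have "(fst w, fst y) \<in> E"
    by (auto simp: blowup_def)
  ultimately show ?case
    using Suc.IH relpow_Suc_I by metis
qed simp

text \<open>
  A walk of positive length lifts with prescribed copies of both ends, passing through the copy 0 of
  every inner vertex. In length 0 this fails, as the two ends may be different copies.
\<close>

lemma relpow_blowup_lift:
  "(u, v) \<in> E ^^ Suc l \<Longrightarrow> i < n u \<Longrightarrow> j < n v \<Longrightarrow> ((u, i), (v, j)) \<in> parcs (blowup G n) ^^ Suc l"
proof (induction l arbitrary: v j)
  case 0
  then show ?case
    using arc_irrefl by (auto simp: blowup_def)
next
  case (Suc l)
  then obtain w where w: "(u, w) \<in> E ^^ Suc l" "(w, v) \<in> E"
    by (metis relpow_Suc_E)
  then have "0 < n w"
    using n arc_in_V by blast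
  then have "((u, i), (w, 0)) \<in> parcs (blowup G n) ^^ Suc l"
    using Suc.IH Suc.prems w by blast
  moreover have "((w, 0), (v, j)) \<in> parcs (blowup G n)"
    using w Suc.prems \<open>0 < n w\<close> arc_irrefl by (auto simp: blowup_def)
  ultimately show ?case
    by (metis relpow_Suc_I)
qed

lemma pverts_blowup: "pverts (blowup G n) = Sigma V (\<lambda>v. {..<n v})"
  by (auto simp: blowup_def)

lemma graph_dist_blowup:
  assumes x: "x \<in> pverts (blowup G n)" and y: "y \<in> pverts (blowup G n)"
  shows "int (graph_dist (blowup G n) x y) = N (fst x) (fst y) + (if x = y then -2 else 0)"
proof -
  obtain u i v j where xy: "x = (u, i)" "y = (v, j)"
    by (cases x, cases y)
  have uv: "u \<in> V" "i < n u" "v \<in> V" "j < n v"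
    using x y by (auto simp: pverts_blowup xy)
  note eq = graph_dist_eq_Least_relpow[OF blowup_wf x]
  consider "x = y" | "u = v" "x \<noteq> y" | "u \<noteq> v"
    by (auto simp: xy)
  then show ?thesis
  proof cases
    case 1
    have "graph_dist (blowup G n) x x = 0"
      unfolding eq by (rule Least_eq_0) simp
    then show ?thesis
      using 1 uv by (simp add: N_def xy)
  next
    case 2
    obtain w where w: "(u, w) \<in> E" "(w, u) \<in> E"
      using ex_neighbour uv arc_sym by blast
    then have "(x, y) \<in> parcs (blowup G n) ^^ 2"
      using relpow_blowup_lift[of u v 1 i j] uv 2 by (auto simp: xy numeral_2_eq_2)
    then have "graph_dist (blowup G n) x y = 2"
      unfolding eq
    proof (rule Least_equality)
      fix l assume l: "(x, y) \<in> parcs (blowup G n) ^^ l"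
      have "l \<noteq> 0"
      proof
        assume "l = 0"
        then show False
          using l 2(2) by simp
      qed
      moreover have "l \<noteq> 1"
      proof
        assume "l = 1"
        then have "(u, v) \<in> E"
          using relpow_blowup_fst[OF l] by (simp add: xy)
        then show False
          using 2(1) arc_irrefl by blast
      qed
      ultimately show "2 \<le> l"
        by simp
    qed
    then show ?thesis
      using 2 uv by (simp add: N_def xy)
  next
    case 3
    have "(x, y) \<in> parcs (blowup G n) ^^ l \<longleftrightarrow> (u, v) \<in> E ^^ l" for l
    proof (cases l)
      case 0
      then show ?thesis
        using 3 by (simp add: xy)
    next
      case (Suc l')
      then show ?thesis
        using relpow_blowup_fst[of x y l] relpow_blowup_lift[of u v l' i j] uv
        by (auto simp: xy simp del: relpow.simps)
    qed
    then have "graph_dist (blowup G n) x y = d u v"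
      unfolding eq using d_eq uv by simp
    then show ?thesis
      using 3 by (simp add: N_def xy)
  qed
qed

lemma det_blowup:
  "det (distance_matrix (blowup G n)) =
    (-2) ^ (\<Sum>v\<in>V. n v - 1) *
    (\<Sum>J\<in>Pow V. (-2) ^ (card V - card J) * set_det J N * (\<Prod>j\<in>J. int (n j)))"
proof -
  let ?K = "pverts (blowup G n)"
  have K: "finite ?K"
    by (simp add: pverts_blowup)
  have "det (distance_matrix (blowup G n)) = set_det ?K (\<lambda>x y. int (graph_dist (blowup G n) x y))"
    unfolding distance_matrix_def
    by (rule det_mat_enumeration) (rule bij_betw_from_nat_into_finite[OF K])
  also have "\<dots> = set_det ?K (\<lambda>x y. N (fst x) (fst y) + (if x = y then -2 else 0))"
    by (rule set_det_cong) (rule graph_dist_blowup)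
  also have "\<dots> = (\<Sum>J\<in>Pow V. of_nat (\<Prod>j\<in>J. n j) * (-2) ^ (card ?K - card J) * set_det J N)"
    unfolding pverts_blowup by (rule set_det_blowup) simp
  also have "\<dots> = (\<Sum>J\<in>Pow V. (-2) ^ (\<Sum>v\<in>V. n v - 1) *
      ((-2) ^ (card V - card J) * set_det J N * (\<Prod>j\<in>J. int (n j))))"
  proof (rule sum.cong[OF refl])
    fix J assume "J \<in> Pow V"
    then have J: "card J \<le> card V"
      by (auto intro: card_mono)
    have "(\<Sum>v\<in>V. n v) = (\<Sum>v\<in>V. (n v - 1) + 1)"
      using n by (intro sum.cong) auto
    then have "(\<Sum>v\<in>V. n v) = (\<Sum>v\<in>V. n v - 1) + card V"
      by (simp only: sum.distrib) simp
    then have "card ?K - card J = (\<Sum>v\<in>V. n v - 1) + (card V - card J)"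
      using J by (simp add: pverts_blowup card_SigmaI)
    then show "of_nat (\<Prod>j\<in>J. n j) * (-2) ^ (card ?K - card J) * set_det J N =
        (-2) ^ (\<Sum>v\<in>V. n v - 1) * ((-2) ^ (card V - card J) * set_det J N * (\<Prod>j\<in>J. int (n j)))"
      by (simp add: power_add)
  qed
  finally show ?thesis
    by (simp add: sum_distrib_left)
qed

end

section \<open>The blowup-polynomial and its homogenization\<close>

definition vertex_monom :: "'a set \<Rightarrow> 'a \<Rightarrow>\<^sub>0 nat" where
  "vertex_monom J = (\<Sum>j\<in>J. Poly_Mapping.single j 1)"

lemma lookup_vertex_monom:
  "finite J \<Longrightarrow> Poly_Mapping.lookup (vertex_monom J) i = (if i \<in> J then 1 else 0)"
  by (simp add: vertex_monom_def lookup_sum lookup_single when_def)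

lemma keys_vertex_monom: "finite J \<Longrightarrow> Poly_Mapping.keys (vertex_monom J) = J"
  by (auto simp: in_keys_iff lookup_vertex_monom split: if_splits)

lemma monom_eval_vertex_monom: "finite J \<Longrightarrow> monom_eval x (vertex_monom J) = prod x J"
  by (simp add: monom_eval_def keys_vertex_monom lookup_vertex_monom)

definition explicit_blowup_polynomial :: "('a, int) mpoly" where
  "explicit_blowup_polynomial =
    (\<Sum>J\<in>Pow V. Poly_Mapping.single (vertex_monom J) ((-2) ^ (card V - card J) * set_det J N))"

lemma eval_explicit_blowup_polynomial:
  fixes h :: "int \<Rightarrow> 'b::comm_ring_1"
  assumes "h 0 = 0" "\<And>a b. h (a + b) = h a + h b"
  shows "eval_with h x explicit_blowup_polynomial =
    (\<Sum>J\<in>Pow V. h ((-2) ^ (card V - card J) * set_det J N) * prod x J)"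
  unfolding explicit_blowup_polynomial_def eval_with_sum[where h = h, OF assms]
    eval_with_single[where h = h, OF assms(1)]
  by (intro sum.cong) (auto simp: monom_eval_vertex_monom finite_subset[OF _ finite_V])

lemma indets_explicit_blowup_polynomial: "indets explicit_blowup_polynomial \<subseteq> V"
proof
  fix v assume "v \<in> indets explicit_blowup_polynomial"
  then obtain m where m: "m \<in> Poly_Mapping.keys explicit_blowup_polynomial" "v \<in> Poly_Mapping.keys m"
    by (auto simp: indets_def)
  then obtain J where "J \<subseteq> V" "m = vertex_monom J"
    unfolding explicit_blowup_polynomial_def by (auto elim: keys_sum_single)
  then show "v \<in> V"
    using m(2) keys_vertex_monom[of J] finite_subset[OF _ finite_V] by auto
qed

lemma blowup_polynomial_eq: "blowup_polynomial G = explicit_blowup_polynomial"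
  unfolding blowup_polynomial_def
proof (rule the_equality)
  have det: "det (distance_matrix (blowup G n)) =
      (- 2) ^ (\<Sum>v\<in>V. n v - 1) * mpeval (\<lambda>v. int (n v)) explicit_blowup_polynomial"
    if "\<forall>v\<in>V. 0 < n v" for n
    using that by (simp add: det_blowup mpeval_eq_eval_with eval_explicit_blowup_polynomial)
  then show "indets explicit_blowup_polynomial \<subseteq> V \<and> (\<forall>n. (\<forall>v\<in>V. 0 < n v) \<longrightarrow>
      det (distance_matrix (blowup G n)) =
      (- 2) ^ (\<Sum>v\<in>V. n v - 1) * mpeval (\<lambda>v. int (n v)) explicit_blowup_polynomial)"
    using indets_explicit_blowup_polynomial by blast
  fix p assume p: "indets p \<subseteq> V \<and> (\<forall>n. (\<forall>v\<in>V. 0 < n v) \<longrightarrow>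
      det (distance_matrix (blowup G n)) =
      (- 2) ^ (\<Sum>v\<in>V. n v - 1) * mpeval (\<lambda>v. int (n v)) p)"
  show "p = explicit_blowup_polynomial"
  proof (rule mpoly_eqI_on_positive_integers)
    fix n :: "'a \<Rightarrow> nat" assume n: "\<And>i. 0 < n i"
    have "(- 2) ^ (\<Sum>v\<in>V. n v - 1) * mpeval (\<lambda>v. int (n v)) p =
        (- 2) ^ (\<Sum>v\<in>V. n v - 1) * mpeval (\<lambda>v. int (n v)) explicit_blowup_polynomial"
      using p det n by metis
    then show "mpeval (\<lambda>v. int (n v)) p = mpeval (\<lambda>v. int (n v)) explicit_blowup_polynomial"
      by simp
  qed
qed

definition hom_monom :: "'a set \<Rightarrow> 'a option \<Rightarrow>\<^sub>0 nat" where
  "hom_monom J = Poly_Mapping.single None (card V - card J) + (\<Sum>j\<in>J. Poly_Mapping.single (Some j) 1)"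

lemma lookup_hom_monom:
  "finite J \<Longrightarrow> Poly_Mapping.lookup (hom_monom J) None = card V - card J"
  "finite J \<Longrightarrow> Poly_Mapping.lookup (hom_monom J) (Some j) = (if j \<in> J then 1 else 0)"
  by (simp_all add: hom_monom_def lookup_add lookup_sum lookup_single when_def)

lemma finite_hom_vars [simp]: "finite (hom_vars G)"
  by (simp add: hom_vars_def)

lemma keys_hom_monom: "J \<subseteq> V \<Longrightarrow> Poly_Mapping.keys (hom_monom J) \<subseteq> hom_vars G"
proof
  fix i assume J: "J \<subseteq> V" and "i \<in> Poly_Mapping.keys (hom_monom J)"
  then show "i \<in> hom_vars G"
    using finite_subset[OF J finite_V]
    by (cases i) (auto simp: hom_vars_def in_keys_iff lookup_hom_monom split: if_splits)
qed

lemma sum_hom_vars: "(\<Sum>i\<in>hom_vars G. f i) = f None + (\<Sum>v\<in>V. f (Some v))"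
  by (simp add: hom_vars_def sum.reindex)

lemma prod_hom_vars: "(\<Prod>i\<in>hom_vars G. f i) = f None * (\<Prod>v\<in>V. f (Some v))"
  by (simp add: hom_vars_def prod.reindex)

lemma monom_eval_hom_monom:
  assumes "J \<subseteq> V"
  shows "monom_eval z (hom_monom J) = z None ^ (card V - card J) * (\<Prod>j\<in>J. z (Some j))"
proof -
  have J: "finite J"
    using assms finite_V by (rule finite_subset)
  have "(\<Prod>v\<in>V. z (Some v) ^ Poly_Mapping.lookup (hom_monom J) (Some v)) = (\<Prod>j\<in>J. z (Some j))"
    by (rule prod.mono_neutral_cong_right) (use assms J in \<open>auto simp: lookup_hom_monom\<close>)
  then show ?thesis
    using J by (simp add: monom_eval_superset[OF finite_hom_vars keys_hom_monom[OF assms]]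
        prod_hom_vars lookup_hom_monom)
qed

text \<open>
  In the \<open>J\<close>-term, homogenizing multiplies the factor \<open>(- 2) ^ (k - |J|)\<close> by
  \<open>(- z\<^sub>0) ^ (k - |J|)\<close>, so the signs cancel.
\<close>

definition explicit_hom_polynomial :: "('a option, real) mpoly" where
  "explicit_hom_polynomial =
    (\<Sum>J\<in>Pow V. Poly_Mapping.single (hom_monom J) (2 ^ (card V - card J) * of_int (set_det J N)))"

lemma eval_explicit_hom_polynomial:
  fixes h :: "real \<Rightarrow> 'b::comm_semiring_1"
  assumes "h 0 = 0" "\<And>a b. h (a + b) = h a + h b"
  shows "eval_with h z explicit_hom_polynomial =
    (\<Sum>J\<in>Pow V. h (2 ^ (card V - card J) * of_int (set_det J N)) *
       (z None ^ (card V - card J) * (\<Prod>j\<in>J. z (Some j))))"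
  unfolding explicit_hom_polynomial_def eval_with_sum[where h = h, OF assms]
    eval_with_single[where h = h, OF assms(1)]
  by (intro sum.cong) (auto simp: monom_eval_hom_monom)

lemma keys_explicit_hom_polynomial:
  assumes "m \<in> Poly_Mapping.keys explicit_hom_polynomial"
  obtains J where "J \<subseteq> V" "m = hom_monom J"
  using assms unfolding explicit_hom_polynomial_def by (auto elim: keys_sum_single)

lemma lookup_explicit_hom_polynomial:
  assumes "J \<subseteq> V"
  shows "Poly_Mapping.lookup explicit_hom_polynomial (hom_monom J) =
    2 ^ (card V - card J) * of_int (set_det J N)"
proof -
  have inj: "hom_monom I = hom_monom J \<longleftrightarrow> I = J" if "I \<subseteq> V" for I
  proof
    assume eq: "hom_monom I = hom_monom J"
    have "v \<in> I \<longleftrightarrow> v \<in> J" for v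
      using arg_cong[OF eq, of "\<lambda>m. Poly_Mapping.lookup m (Some v)"] that assms
      by (simp add: lookup_hom_monom finite_subset[OF _ finite_V] split: if_splits)
    then show "I = J"
      by blast
  qed simp
  have "Poly_Mapping.lookup explicit_hom_polynomial (hom_monom J) =
     (\<Sum>I\<in>Pow V. if I = J then 2 ^ (card V - card I) * of_int (set_det I N) else 0)"
    unfolding explicit_hom_polynomial_def lookup_sum
    by (intro sum.cong) (auto simp: lookup_single when_def inj)
  then show ?thesis
    using assms by simp
qed

lemma indets_explicit_hom_polynomial: "indets explicit_hom_polynomial \<subseteq> hom_vars G"
  unfolding indets_def
proof (rule UN_least)
  fix m assume "m \<in> Poly_Mapping.keys explicit_hom_polynomial"
  then obtain J where "J \<subseteq> V" "m = hom_monom J"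
    by (rule keys_explicit_hom_polynomial)
  then show "Poly_Mapping.keys m \<subseteq> hom_vars G"
    by (simp add: keys_hom_monom)
qed

lemma mpeval_explicit_hom_polynomial:
  assumes z: "z None \<noteq> (0::real)"
  shows "mpeval z explicit_hom_polynomial =
    (- z None) ^ card V *
    mpeval (\<lambda>v. z (Some v) / (- z None)) (Poly_Mapping.map real_of_int (blowup_polynomial G))"
proof -
  have *: "(- z None) ^ card V * (of_int ((-2) ^ (card V - card J) * set_det J N) *
        (\<Prod>j\<in>J. z (Some j) / (- z None))) =
      2 ^ (card V - card J) * of_int (set_det J N) * (z None ^ (card V - card J) * (\<Prod>j\<in>J. z (Some j)))"
    if "J \<subseteq> V" for J
  proof -
    have "card J \<le> card V"
      using that by (simp add: card_mono)
    then have 1: "(- z None) ^ card V = (- z None) ^ (card V - card J) * (- z None) ^ card J"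
      unfolding power_add[symmetric] by simp
    have 2: "(\<Prod>j\<in>J. z (Some j) / (- z None)) * (- z None) ^ card J = (\<Prod>j\<in>J. z (Some j))"
      unfolding prod_dividef prod_constant using z by simp
    have 3: "(- z None) ^ (card V - card J) * (-2) ^ (card V - card J) =
        2 ^ (card V - card J) * z None ^ (card V - card J)"
      unfolding power_mult_distrib[symmetric] by simp
    have "(- z None) ^ card V * (of_int ((-2) ^ (card V - card J) * set_det J N) *
        (\<Prod>j\<in>J. z (Some j) / (- z None))) =
      ((- z None) ^ (card V - card J) * (-2) ^ (card V - card J)) * of_int (set_det J N) *
        ((\<Prod>j\<in>J. z (Some j) / (- z None)) * (- z None) ^ card J)"
      unfolding 1 of_int_mult of_int_power of_int_minus of_int_numeral of_int_neg_numeral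
      by (simp only: mult_ac)
    then show ?thesis
      unfolding 2 3 by (simp only: mult_ac)
  qed
  have "mpeval (\<lambda>v. z (Some v) / (- z None)) (Poly_Mapping.map real_of_int (blowup_polynomial G)) =
      eval_with real_of_int (\<lambda>v. z (Some v) / (- z None)) explicit_blowup_polynomial"
    unfolding blowup_polynomial_eq by (rule mpeval_map) simp_all
  also have "\<dots> = (\<Sum>J\<in>Pow V. of_int ((-2) ^ (card V - card J) * set_det J N) *
      (\<Prod>j\<in>J. z (Some j) / (- z None)))"
    by (rule eval_explicit_blowup_polynomial) simp_all
  finally have "(- z None) ^ card V *
      mpeval (\<lambda>v. z (Some v) / (- z None)) (Poly_Mapping.map real_of_int (blowup_polynomial G)) =
    (\<Sum>J\<in>Pow V. 2 ^ (card V - card J) * of_int (set_det J N) *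
      (z None ^ (card V - card J) * (\<Prod>j\<in>J. z (Some j))))"
    by (simp only: sum_distrib_left) (rule sum.cong[OF refl], rule *, simp)
  also have "\<dots> = mpeval z explicit_hom_polynomial"
    unfolding mpeval_eq_eval_with by (rule eval_explicit_hom_polynomial[symmetric]) simp_all
  finally show ?thesis ..
qed

lemma hom_blowup_polynomial_eq: "hom_blowup_polynomial G = explicit_hom_polynomial"
  unfolding hom_blowup_polynomial_def
proof (rule the_equality)
  fix q :: "('a option, real) mpoly"
  assume q: "indets q \<subseteq> hom_vars G \<and> (\<forall>z. z None \<noteq> 0 \<longrightarrow>
    mpeval z q = (- z None) ^ card V *
      mpeval (\<lambda>v. z (Some v) / (- z None)) (Poly_Mapping.map real_of_int (blowup_polynomial G)))"
  show "q = explicit_hom_polynomial"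
  proof (rule mpoly_eqI_on_positive_integers)
    fix n :: "'a option \<Rightarrow> nat" assume n: "\<And>i. 0 < n i"
    let ?z = "\<lambda>i. real (n i)"
    have z: "?z None \<noteq> 0"
      using n[of None] by simp
    show "mpeval ?z q = mpeval ?z explicit_hom_polynomial"
      using q[THEN conjunct2, THEN spec[of _ ?z], THEN mp, OF z]
        mpeval_explicit_hom_polynomial[of ?z, OF z] by (rule trans[OF _ sym])
  qed
qed (intro conjI allI impI indets_explicit_hom_polynomial mpeval_explicit_hom_polynomial)

section \<open>Complete multipartite graphs and positive semidefiniteness\<close>

lemma N_symmetric: "u \<in> V \<Longrightarrow> v \<in> V \<Longrightarrow> N u v = N v u"
  using d_sym by (auto simp: N_def)

lemma d_eq_2:
  assumes "u \<in> V" "v \<in> V" "u \<noteq> v" "(u, v) \<notin> E" "(u, w) \<in> E" "(w, v) \<in> E"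
  shows "d u v = 2"
proof (rule antisym)
  have "(u, v) \<in> E ^^ 2"
    using assms(5,6) by (auto simp: numeral_2_eq_2)
  with assms(1) show "d u v \<le> 2"
    by (rule d_le)
qed (rule d_ge_2[OF assms(1-4)])

text \<open>
  With \<open>a\<close> and \<open>b\<close> the distances from \<open>w\<close> to the ends of the edge, the minor is
  \<open>6 - (a - b)\<^sup>2 - a\<^sup>2 - b\<^sup>2\<close>, where \<open>a \<ge> 2\<close> and \<open>b \<ge> 2\<close>.
\<close>

lemma induced_edge_plus_vertex_minor_negative:
  assumes V: "u \<in> V" "v \<in> V" "w \<in> V"
    and E: "(u, v) \<in> E" "(u, w) \<notin> E" "(w, v) \<notin> E"
  shows "set_det {u, v, w} N < 0"
proof -
  have ne: "u \<noteq> v" "u \<noteq> w" "v \<noteq> w"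
    using E arc_irrefl by auto
  define a b where "a = N u w" and "b = N v w"
  have a: "2 \<le> a" and b: "2 \<le> b"
    using d_ge_2[of u w] d_ge_2[of v w] V E ne arc_sym[of v w] by (auto simp: a_def b_def N_def)
  have "set_det {u, v, w} N = 6 + 2 * a * b - 2 * a * a - 2 * b * b"
    unfolding set_det_3[OF ne] using V ne d_arc[OF E(1)] d_arc[OF arc_sym[OF E(1)]]
      N_symmetric[of w u] N_symmetric[of w v]
    by (simp add: N_def[of u u] N_def[of v v] N_def[of w w] N_def[of u v] N_def[of v u]
        a_def[symmetric] b_def[symmetric] algebra_simps)
  also have "\<dots> = 6 - (a - b) * (a - b) - a * a - b * b"
    by (simp add: algebra_simps)
  also have "\<dots> < 0"
    using mult_mono[OF a a] mult_mono[OF b b] a b zero_le_square[of "a - b"] by linarith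
  finally show ?thesis .
qed

text \<open>
  The parts are the classes of non-adjacency; it is transitive because a violation would be an edge
  together with a vertex that is adjacent to neither end.
\<close>

lemma complete_multipartite_if_coefficients_nonneg:
  assumes "\<And>m. 0 \<le> Poly_Mapping.lookup (hom_blowup_polynomial G) m"
  shows "complete_multipartite G"
proof -
  define R where "R = {(u, v). u \<in> V \<and> v \<in> V \<and> (u, v) \<notin> E}"
  have minor: "0 \<le> set_det J N" if "J \<subseteq> V" for J
    using assms[of "hom_monom J"]
    by (simp add: hom_blowup_polynomial_eq lookup_explicit_hom_polynomial[OF that] zero_le_mult_iff power_le_zero_eq)
  have "equiv V R"
  proof (intro equivI)
    show "trans R"
    proof (rule transI)
      fix u w v assume "(u, w) \<in> R" "(w, v) \<in> R"
      then show "(u, v) \<in> R"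
        using induced_edge_plus_vertex_minor_negative[of u v w] minor[of "{u, v, w}"]
        by (force simp: R_def)
    qed
  qed (use arc_irrefl arc_sym in \<open>auto simp: R_def refl_on_def sym_def\<close>)
  then have "partition_on V (V // R)"
    by (rule partition_on_quotient)
  moreover have *: "(\<exists>B\<in>V // R. u \<in> B \<and> v \<in> B) \<longleftrightarrow> (u, v) \<in> R" if "u \<in> V" "v \<in> V" for u v
  proof
    assume "\<exists>B\<in>V // R. u \<in> B \<and> v \<in> B"
    then show "(u, v) \<in> R"
      using in_quotient_imp_in_rel[OF \<open>equiv V R\<close>] by blast
  next
    assume "(u, v) \<in> R"
    then have "u \<in> R `` {u} \<and> v \<in> R `` {u}"
      using equiv_class_self[OF \<open>equiv V R\<close> that(1)] by simp
    then show "\<exists>B\<in>V // R. u \<in> B \<and> v \<in> B"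
      by (rule bexI[of _ "R `` {u}"]) (rule quotientI[OF that(1)])
  qed
  have "E = {(u, v). u \<in> V \<and> v \<in> V \<and> \<not> (\<exists>B\<in>V // R. u \<in> B \<and> v \<in> B)}"
  proof (rule Set.set_eqI)
    fix e :: "'a \<times> 'a"
    obtain u v where e: "e = (u, v)"
      by (cases e)
    have "(u, v) \<in> E \<longleftrightarrow> u \<in> V \<and> v \<in> V \<and> (u, v) \<notin> R"
      using arc_in_V[of u v] by (auto simp: R_def)
    also have "\<dots> \<longleftrightarrow> u \<in> V \<and> v \<in> V \<and> \<not> (\<exists>B\<in>V // R. u \<in> B \<and> v \<in> B)"
      using *[of u v] by blast
    finally show "e \<in> E \<longleftrightarrow> e \<in> {(u, v). u \<in> V \<and> v \<in> V \<and> \<not> (\<exists>B\<in>V // R. u \<in> B \<and> v \<in> B)}"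
      by (simp only: e mem_Collect_eq case_prod_conv)
  qed
  ultimately show ?thesis
    unfolding complete_multipartite_def by (intro exI[of _ "V // R"] conjI)
qed

context
  fixes P
  assumes P: "partition_on V P"
    and E_P: "E = {(v, w). v \<in> V \<and> w \<in> V \<and> \<not> (\<exists>B\<in>P. v \<in> B \<and> w \<in> B)}"
begin

lemma block_unique: "B \<in> P \<Longrightarrow> C \<in> P \<Longrightarrow> x \<in> B \<Longrightarrow> x \<in> C \<Longrightarrow> B = C"
  using P unfolding partition_on_def disjoint_def by blast

text \<open>
  Different vertices of the same part have distance 2: a neighbour of the first lies in
  another part and is therefore adjacent to the second as well.
\<close>

lemma N_eq:
  assumes "u \<in> V" "v \<in> V"
  shows "N u v = 1 + (if \<exists>B\<in>P. u \<in> B \<and> v \<in> B then 1 else 0)"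
proof (cases "\<exists>B\<in>P. u \<in> B \<and> v \<in> B")
  case True
  then have nE: "(u, v) \<notin> E"
    by (auto simp: E_P)
  show ?thesis
  proof (cases "u = v")
    case True
    then show ?thesis
      using \<open>\<exists>B\<in>P. u \<in> B \<and> v \<in> B\<close> assms by (auto simp: N_def)
  next
    case False
    obtain w where w: "(u, w) \<in> E"
      using ex_neighbour assms by blast
    have "(w, v) \<in> E"
    proof (rule ccontr)
      assume "(w, v) \<notin> E"
      then obtain C where C: "C \<in> P" "w \<in> C" "v \<in> C"
        using assms(2) arc_in_V[OF w] by (auto simp: E_P)
      moreover obtain B where B: "B \<in> P" "u \<in> B" "v \<in> B"
        using True by blast
      ultimately have "B = C"
        using block_unique by blast
      then show False
        using w B C by (auto simp: E_P)
    qed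
    then have "d u v = 2"
      using d_eq_2 assms False nE w by blast
    then show ?thesis
      using False True by (simp add: N_def)
  qed
next
  case False
  then have "(u, v) \<in> E"
    using assms by (subst E_P) auto
  then show ?thesis
    using d_arc arc_irrefl False by (auto simp: N_def)
qed

text \<open>
  Vertices of the same part have equal rows. If \<open>J\<close> has at most one vertex in every part, then the
  submatrix on \<open>J\<close> is the identity plus the all-ones matrix, and the diagonal expansion of its
  determinant is a sum of minors of the all-ones matrix.
\<close>

lemma minor_nonneg:
  assumes "J \<subseteq> V"
  shows "0 \<le> set_det J N"
proof (cases "\<exists>u\<in>J. \<exists>v\<in>J. u \<noteq> v \<and> (\<exists>B\<in>P. u \<in> B \<and> v \<in> B)")
  case True
  then obtain u v B where uv: "u \<in> J" "v \<in> J" "u \<noteq> v" "B \<in> P" "u \<in> B" "v \<in> B"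
    by blast
  have "N u x = N v x" if "x \<in> J" for x
  proof -
    have "(\<exists>C\<in>P. u \<in> C \<and> x \<in> C) \<longleftrightarrow> (\<exists>C\<in>P. v \<in> C \<and> x \<in> C)"
      using uv block_unique by blast
    then show ?thesis
      using uv that assms by (simp add: N_eq subset_iff)
  qed
  then have "set_det J N = 0"
    using uv assms finite_subset[OF assms finite_V] by (intro set_det_equal_rows[of J u v]) auto
  then show ?thesis
    by simp
next
  case False
  have J: "finite J"
    using assms finite_V by (rule finite_subset)
  have "set_det J N = set_det J (\<lambda>x y. 1 + (if x = y then 1 else 0))"
  proof (rule set_det_cong)
    fix u v assume uv: "u \<in> J" "v \<in> J"
    then have "u \<in> V" "v \<in> V"
      using assms by auto
    moreover from this have "\<exists>B\<in>P. u \<in> B"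
      using P by (auto simp: partition_on_def)
    ultimately show "N u v = 1 + (if u = v then 1 else 0)"
      using False uv by (auto simp: N_eq)
  qed
  also have "\<dots> = (\<Sum>T\<in>Pow J. 1 ^ card (J - T) * set_det T (\<lambda>_ _. 1))"
    by (rule set_det_add_diagonal[OF J])
  also have "\<dots> \<ge> 0"
    using J by (intro sum_nonneg) (auto intro!: set_det_all_ones_nonneg intro: finite_subset)
  finally show ?thesis .
qed

text \<open>
  \<open>N\<close> is the sum of \<open>e e\<^sup>T\<close> over the all-ones vector and the indicator vectors of the parts.
\<close>

lemma N_positive_semidefinite:
  "\<exists>R\<ge>0. (\<Sum>x\<in>V. \<Sum>y\<in>V. cnj (w x) * of_int (N x y) * w y) = complex_of_real R"
proof -
  have fP: "finite P"
    using P finite_V by (rule finite_elements[rotated])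
  let ?i = "\<lambda>B x. (if x \<in> B then 1 else 0 :: complex)"
  let ?s = "\<lambda>c. \<Sum>x\<in>V. c x * w x"
  have N: "of_int (N x y) = 1 + (\<Sum>B\<in>P. ?i B x * ?i B y)" if "x \<in> V" "y \<in> V" for x y
  proof (cases "\<exists>B\<in>P. x \<in> B \<and> y \<in> B")
    case True
    then obtain B where B: "B \<in> P" "x \<in> B" "y \<in> B"
      by blast
    then have "(\<Sum>C\<in>P. ?i C x * ?i C y) = (\<Sum>C\<in>P. if C = B then 1 else 0)"
      using block_unique by (intro sum.cong refl) auto
    then show ?thesis
      using True that B fP by (simp add: N_eq)
  next
    case False
    then have "(\<Sum>C\<in>P. ?i C x * ?i C y) = 0"
      by (intro sum.neutral) auto
    then show ?thesis
      using False that by (simp add: N_eq)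
  qed
  have square: "(\<Sum>x\<in>V. \<Sum>y\<in>V. cnj (w x) * (c x * c y) * w y) = of_real ((cmod (?s c))\<^sup>2)"
    if "\<And>x. cnj (c x) = c x" for c
  proof -
    have "of_real ((cmod (?s c))\<^sup>2) = (\<Sum>x\<in>V. cnj (c x * w x)) * ?s c"
      unfolding complex_norm_square cnj_sum by (rule mult.commute)
    also have "\<dots> = (\<Sum>x\<in>V. \<Sum>y\<in>V. cnj (c x * w x) * (c y * w y))"
      by (rule sum_product)
    finally show ?thesis
      by (simp add: that mult_ac)
  qed
  let ?t = "\<lambda>B x y. cnj (w x) * (?i B x * ?i B y) * w y"
  have "(\<Sum>x\<in>V. \<Sum>y\<in>V. cnj (w x) * of_int (N x y) * w y) =
      (\<Sum>x\<in>V. \<Sum>y\<in>V. cnj (w x) * (1 * 1) * w y + (\<Sum>B\<in>P. ?t B x y))"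
  proof (intro sum.cong[OF refl])
    fix x y assume xy: "x \<in> V" "y \<in> V"
    have "(\<Sum>B\<in>P. ?t B x y) = cnj (w x) * (\<Sum>B\<in>P. ?i B x * ?i B y) * w y"
      by (simp only: sum_distrib_left sum_distrib_right)
    then show "cnj (w x) * of_int (N x y) * w y =
        cnj (w x) * (1 * 1) * w y + (\<Sum>B\<in>P. ?t B x y)"
      unfolding N[OF xy] by (simp only: distrib_left distrib_right mult_1)
  qed
  also have "\<dots> = (\<Sum>x\<in>V. \<Sum>y\<in>V. cnj (w x) * (1 * 1) * w y) + (\<Sum>x\<in>V. \<Sum>y\<in>V. \<Sum>B\<in>P. ?t B x y)"
    by (simp only: sum.distrib)
  also have "(\<Sum>x\<in>V. \<Sum>y\<in>V. \<Sum>B\<in>P. ?t B x y) = (\<Sum>x\<in>V. \<Sum>B\<in>P. \<Sum>y\<in>V. ?t B x y)"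
    by (rule sum.cong[OF refl]) (rule sum.swap)
  also have "\<dots> = (\<Sum>B\<in>P. \<Sum>x\<in>V. \<Sum>y\<in>V. ?t B x y)"
    by (rule sum.swap)
  also have "\<dots> = (\<Sum>B\<in>P. of_real ((cmod (?s (?i B)))\<^sup>2))"
    by (rule sum.cong[OF refl]) (rule square, simp)
  also have "(\<Sum>x\<in>V. \<Sum>y\<in>V. cnj (w x) * (1 * 1) * w y) = of_real ((cmod (?s (\<lambda>_. 1)))\<^sup>2)"
    by (rule square) simp
  also have "of_real ((cmod (?s (\<lambda>_. 1)))\<^sup>2) + (\<Sum>B\<in>P. of_real ((cmod (?s (?i B)))\<^sup>2)) =
      complex_of_real ((cmod (?s (\<lambda>_. 1)))\<^sup>2 + (\<Sum>B\<in>P. (cmod (?s (?i B)))\<^sup>2))"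
    by (simp only: of_real_add of_real_sum)
  finally show ?thesis
    by (intro exI[of _ "(cmod (?s (\<lambda>_. 1)))\<^sup>2 + (\<Sum>B\<in>P. (cmod (?s (?i B)))\<^sup>2)"] conjI)
      (auto intro!: add_nonneg_nonneg sum_nonneg)
qed

text \<open>
  Coefficients are non-negative because they are positive multiples of principal minors of
  \<open>N\<close>, which are non-negative.
  For stability, the polynomial is read as the diagonal expansion of the determinant of
  \<open>N diag(z\<^sub>1, \<dots>, z\<^sub>k) + 2 z\<^sub>0 I\<close>.
\<close>

lemma stable_form_hom_blowup_polynomial:
  "stable_form (hom_vars G) (card V) (hom_blowup_polynomial G)"
  unfolding stable_form_def hom_blowup_polynomial_eq
proof (intro conjI allI ballI impI)
  show "indets explicit_hom_polynomial \<subseteq> hom_vars G"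
    by (rule indets_explicit_hom_polynomial)
  show "0 \<le> Poly_Mapping.lookup explicit_hom_polynomial m" for m
  proof (cases "m \<in> Poly_Mapping.keys explicit_hom_polynomial")
    case True
    then obtain J where "J \<subseteq> V" "m = hom_monom J"
      by (rule keys_explicit_hom_polynomial)
    then show ?thesis
      using minor_nonneg by (simp add: lookup_explicit_hom_polynomial)
  qed (simp add: in_keys_iff)
  show "(\<Sum>i\<in>hom_vars G. Poly_Mapping.lookup m i) = card V"
    if m: "m \<in> Poly_Mapping.keys explicit_hom_polynomial" for m
  proof -
    obtain J where J: "J \<subseteq> V" "m = hom_monom J"
      using m by (rule keys_explicit_hom_polynomial)
    then have "finite J" "card J \<le> card V" "V \<inter> J = J"
      by (auto intro: finite_subset card_mono)
    then show ?thesis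
      using J by (simp add: sum_hom_vars lookup_hom_monom sum.If_cases)
  qed
  fix z :: "'a option \<Rightarrow> complex" assume z: "\<forall>i\<in>hom_vars G. 0 < Im (z i)"
  let ?N = "\<lambda>x y. complex_of_int (N x y)"
  have "eval_with of_real z explicit_hom_polynomial =
      (\<Sum>J\<in>Pow V. of_real (2 ^ (card V - card J) * of_int (set_det J N)) *
        (z None ^ (card V - card J) * (\<Prod>j\<in>J. z (Some j))))"
    by (rule eval_explicit_hom_polynomial) simp_all
  also have "\<dots> = (\<Sum>J\<in>Pow V. (2 * z None) ^ card (V - J) *
        set_det J (\<lambda>x y. ?N x y * z (Some y)))"
  proof (rule sum.cong[OF refl])
    fix J assume "J \<in> Pow V"
    then have "finite J"
      by (auto intro: finite_subset)
    moreover from this have "card (V - J) = card V - card J"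
      using \<open>J \<in> Pow V\<close> by (simp add: card_Diff_subset)
    ultimately show "of_real (2 ^ (card V - card J) * of_int (set_det J N)) *
        (z None ^ (card V - card J) * (\<Prod>j\<in>J. z (Some j))) =
        (2 * z None) ^ card (V - J) * set_det J (\<lambda>x y. ?N x y * z (Some y))"
      by (simp add: set_det_scale_columns power_mult_distrib flip: of_int_set_det)
  qed
  also have "\<dots> = set_det V (\<lambda>x y. ?N x y * z (Some y) + (if x = y then 2 * z None else 0))"
    by (rule set_det_add_diagonal[symmetric]) simp
  also have "\<dots> \<noteq> 0"
    using z by (intro set_det_pencil_nonzero N_positive_semidefinite) (auto simp: hom_vars_def)
  finally show "eval_with of_real z explicit_hom_polynomial \<noteq> 0" .
qed

end

end

theorem corollary2p4:
  fixes G :: "'a pair_pre_digraph"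
  assumes "pair_graph G"
    and "Digraph_Component.connected (with_proj G)"
    and "card (pverts G) \<ge> 2"
  shows "(strongly_log_concave (hom_vars G) (hom_blowup_polynomial G)
            \<longleftrightarrow> complete_multipartite G) \<and>
         (completely_log_concave (hom_vars G) (hom_blowup_polynomial G)
            \<longleftrightarrow> complete_multipartite G)"
proof -
  interpret connected_simple_graph G
    using assms by (simp add: connected_simple_graph_def)
  let ?S = "hom_vars G" and ?p = "hom_blowup_polynomial G"
  have "stable_form ?S (card V) ?p" if "complete_multipartite G"
  proof -
    obtain P where "partition_on V P"
      "E = {(v, w). v \<in> V \<and> w \<in> V \<and> \<not> (\<exists>B\<in>P. v \<in> B \<and> w \<in> B)}"
      using \<open>complete_multipartite G\<close> unfolding complete_multipartite_def by (elim exE conjE)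
    then show ?thesis
      by (rule stable_form_hom_blowup_polynomial)
  qed
  note * = stable_form_strongly_and_completely_log_concave[OF finite_hom_vars this]
  have "complete_multipartite G" if "strongly_log_concave ?S ?p \<or> completely_log_concave ?S ?p"
  proof (rule complete_multipartite_if_coefficients_nonneg)
    show "0 \<le> Poly_Mapping.lookup ?p m" for m
      using that by (auto simp: strongly_log_concave_def completely_log_concave_def)
  qed
  then show ?thesis
    using * by blast
qed

end
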